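(* Let $k\ge 2$ and $n\ge 20k^2$ be integers. Let $G$ be a connected graph on $n$ vertices with at most $\left(1+\frac{1}{54k^2}\right)n$ edges and with maximum degree $\Delta(G)<n-\frac{\sqrt{n}}{2}$. Then $$r(G,P_k)=n+\lfloor k/2\rfloor-1.$$
   Context: All graphs are finite and simple. For graphs $H_1,H_2$, the Ramsey number $r(H_1,H_2)$ is the smallest positive integer $N$ such that every graph $\Gamma$ on $N$ vertices contains $H_1$ as a (not necessarily induced) subgraph or its complement $\overline{\Gamma}$ contains $H_2$ as a subgraph. $P_k$ is the path on $k$ vertices. *)

theory Defs
  imports Complex_Main "Graph_Theory.Graph_Theory"
begin

text \<open>
  A finite simple graph is a \<^locale>\<open>pair_graph\<close>: a finite vertex set with a finite, symmetric,
  loop-free set of ordered pairs of vertices.  An undirected edge is therefore represented by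
  two arcs.
\<close>

definition uedges :: "'a pair_pre_digraph \<Rightarrow> 'a set set" where
  "uedges G = {{u, v} | u v. (u, v) \<in> parcs G}"

text \<open>
  As the arc set of a simple graph is symmetric, the out-degree of a vertex is its number of
  neighbours.  The maximum is meant for graphs with at least one vertex.
\<close>

definition max_degree :: "'a pair_pre_digraph \<Rightarrow> nat" where
  "max_degree G = Max (out_degree (with_proj G) ` pverts G)"

definition complement_graph :: "'a pair_pre_digraph \<Rightarrow> 'a pair_pre_digraph" where
  "complement_graph G =
     \<lparr> pverts = pverts G,
       parcs = {(u, v). u \<in> pverts G \<and> v \<in> pverts G \<and> u \<noteq> v \<and> (u, v) \<notin> parcs G} \<rparr>"

definition path_graph :: "nat \<Rightarrow> nat pair_pre_digraph" where
  "path_graph k =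
     \<lparr> pverts = {..<k}, parcs = {(i, j). i < k \<and> j < k \<and> (j = Suc i \<or> i = Suc j)} \<rparr>"

text \<open>The subgraph need not be induced, and it is a copy of \<open>H\<close> up to isomorphism.\<close>

definition contains_graph :: "'b pair_pre_digraph \<Rightarrow> 'a pair_pre_digraph \<Rightarrow> bool" where
  "contains_graph G H \<longleftrightarrow>
     (\<exists>S :: 'b pair_pre_digraph.
        subgraph (with_proj S) (with_proj G) \<and> digraph_iso (with_proj H) (with_proj S))"

text \<open>
  The host graphs have vertices of type \<^typ>\<open>nat\<close>.  This is no restriction, since every finite
  graph is isomorphic to such a graph.  By Ramsey's theorem the minimum is over a nonempty set
  when \<open>H1\<close> and \<open>H2\<close> are finite simple graphs.
\<close>

definition ramsey_number :: "'a pair_pre_digraph \<Rightarrow> 'b pair_pre_digraph \<Rightarrow> nat" where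
  "ramsey_number H1 H2 =
     (LEAST N. 0 < N \<and>
        (\<forall>\<Gamma> :: nat pair_pre_digraph. pair_graph \<Gamma> \<and> card (pverts \<Gamma>) = N \<longrightarrow>
           contains_graph \<Gamma> H1 \<or> contains_graph (complement_graph \<Gamma>) H2))"

lemma pair_graph_complement_graph: "pair_graph G \<Longrightarrow> pair_graph (complement_graph G)"
proof -
  assume "pair_graph G"
  then interpret G: pair_graph G .
  have f: "finite (pverts G)" by (rule G.pair_finite_verts)
  have "finite (parcs (complement_graph G))"
    by (rule finite_subset[of _ "pverts G \<times> pverts G"]) (auto simp: complement_graph_def f)
  moreover have "sym (parcs G)" using G.pair_sym_arcs by (simp add: symmetric_def)
  ultimately show ?thesis using f
    by unfold_locales (auto simp: complement_graph_def symmetric_def sym_def)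
qed

lemma pair_graph_path_graph: "pair_graph (path_graph k)"
proof -
  have "finite (parcs (path_graph k))"
    by (rule finite_subset[of _ "{..<k} \<times> {..<k}"]) (auto simp: path_graph_def)
  then show ?thesis by unfold_locales (auto simp: path_graph_def symmetric_def sym_def)
qed

lemma contains_graph_iff_embedding:
  assumes "pair_graph G" "pair_graph H"
  shows "contains_graph G H \<longleftrightarrow> (\<exists>f. inj_on f (pverts H) \<and> f ` pverts H \<subseteq> pverts G \<and>
     (\<forall>u v. (u,v) \<in> parcs H \<longrightarrow> (f u, f v) \<in> parcs G))" (is "_ = ?R")
proof
  interpret G: pair_graph G by fact
  interpret H: pair_graph H by fact
  { assume "contains_graph G H"
    then obtain S f where S: "subgraph (with_proj S) (with_proj G)"
      and f: "pre_digraph.digraph_isomorphism (with_proj H) f" "with_proj S = app_iso f (with_proj H)"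
      unfolding contains_graph_def digraph_iso_def by blast
    have v: "pverts S = iso_verts f ` pverts H" and a: "parcs S = iso_arcs f ` parcs H"
      and t: "iso_tail f = fst" and h: "iso_head f = snd"
      using arg_cong[OF f(2), of verts] arg_cong[OF f(2), of arcs]
        arg_cong[OF f(2), of tail] arg_cong[OF f(2), of head] by auto
    have i: "inj_on (iso_verts f) (pverts H)"
      and e: "\<And>a. a \<in> parcs H \<Longrightarrow> iso_arcs f a = (iso_verts f (fst a), iso_verts f (snd a))"
      using f(1) t h by (auto simp: pre_digraph.digraph_isomorphism_def prod_eq_iff)
    have s: "pverts S \<subseteq> pverts G" "parcs S \<subseteq> parcs G" using S by (auto simp: subgraph_def)
    show ?R using i v s a e by (intro exI[of _ "iso_verts f"]) force }
  { assume ?R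
    then obtain f where f: "inj_on f (pverts H)" "f ` pverts H \<subseteq> pverts G"
      "\<And>u v. (u,v) \<in> parcs H \<Longrightarrow> (f u, f v) \<in> parcs G" by blast
    define S where "S = \<lparr>pverts = f ` pverts H, parcs = map_prod f f ` parcs H\<rparr>"
    define i where "i = \<lparr>iso_verts = f, iso_arcs = map_prod f f, iso_head = snd, iso_tail = fst\<rparr>"
    have W: "wf_digraph (with_proj S)"
      by unfold_locales (auto simp: S_def intro!: imageI dest: H.arc_fst_in_verts H.arc_snd_in_verts)
    have "subgraph (with_proj S) (with_proj G)"
      using f W G.wf_digraph unfolding subgraph_def compatible_def S_def by auto
    moreover have "inj_on (map_prod f f) (parcs H)"
      using f(1) H.arc_fst_in_verts H.arc_snd_in_verts by (auto simp: inj_on_def; metis fst_conv snd_conv)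
    then have "pre_digraph.digraph_isomorphism (with_proj H) i"
      unfolding pre_digraph.digraph_isomorphism_def using f(1) H.wf_digraph by (auto simp: i_def)
    moreover have "with_proj S = app_iso i (with_proj H)"
      by (simp add: app_iso_def i_def S_def with_proj_def)
    ultimately show "contains_graph G H" unfolding contains_graph_def digraph_iso_def by blast }
qed

end

theory Submission
  imports Defs
begin

text \<open>
  For the lower bound take two disjoint cliques on \<open>n - 1\<close> and \<open>k div 2 - 1\<close> vertices.  For the upper bound
  let \<open>R\<close> be a graph without path on \<open>k\<close> vertices on \<open>n + k div 2 - 1\<close> vertices; \<open>G\<close> has to be placed so
  that none of its edges becomes an edge of \<open>R\<close>.  Since \<open>R\<close> is \<open>(k - 2)\<close>-degenerate, few of its vertices
  have large degree, and \<open>k div 2\<close> vertices of \<open>R\<close> never have many common neighbours pairwise.  \<open>G\<close> is a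
  tree plus few edges, so after the few vertices on non-tree edges have been put on an independent set of
  low-degree vertices of \<open>R\<close>, everything else can be placed greedily from the root on, as long as there
  are enough spare vertices.

  If more than a quarter of the vertices of \<open>G\<close> are leaves, the leaves are placed last, with as few
  conflicts as possible.  If a conflict cannot be removed by an exchange, then \<open>k div 2\<close> vertices of \<open>R\<close> are
  joined to all parents of almost all leaves.  So there are at most \<open>k div 2\<close> such parents, and the vertex
  with the most leaves is one of them; this is avoided by putting that vertex on a vertex of \<open>R\<close> of degree
  less than \<open>k div 2\<close>.  If there is none, all degrees in \<open>R\<close> are at most \<open>k - 2\<close>, and the bound on the maximum
  degree of \<open>G\<close> provides independent non-neighbours to fill up the neighbourhood in \<open>R\<close>.

  If there are few leaves, the high-degree vertices of \<open>R\<close> are filled with vertices of \<open>G\<close> of degree at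
  most 2 that are far apart.  Then the neighbours of these and the vertices of degree at least 4 are placed
  greedily, the rest arbitrarily, and conflicts are removed by swapping two vertices at a time.
\<close>

section \<open>Graphs without a long path\<close>

locale ugraph =
  fixes V :: "'a set" and E :: "'a \<Rightarrow> 'a \<Rightarrow> bool"
  assumes finite_V: "finite V"
    and sym: "E u v \<Longrightarrow> E v u"
    and irrefl: "\<not> E v v"
    and in_V: "E u v \<Longrightarrow> u \<in> V"
begin

definition nb :: "'a \<Rightarrow> 'a set" where
  "nb v = {w. E v w}"

definition deg :: "'a \<Rightarrow> nat" where
  "deg v = card (nb v)"

definition gpath :: "'a list \<Rightarrow> bool" where
  "gpath xs \<longleftrightarrow> distinct xs \<and> set xs \<subseteq> V \<and> successively E xs"

lemma in_V2: "E u v \<Longrightarrow> v \<in> V"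
  using sym in_V by blast

lemma in_nb [simp]: "w \<in> nb v \<longleftrightarrow> E v w"
  by (simp add: nb_def)

lemma nb_subset: "nb v \<subseteq> V"
  using in_V2 by auto

lemma finite_nb [simp]: "finite (nb v)"
  using nb_subset finite_V finite_subset by blast

lemma not_self_nb: "v \<notin> nb v"
  using irrefl by simp

lemma card_UN_nb_le: "finite A \<Longrightarrow> (\<And>v. v \<in> A \<Longrightarrow> deg v \<le> d) \<Longrightarrow> card (\<Union>v\<in>A. nb v) \<le> card A * d"
  by (metis (no_types, lifting) card_UN_le deg_def order_trans sum_bounded_above of_nat_id)

lemma sum_deg: "(\<Sum>v\<in>V. deg v) = card {(u, v). E u v}"
proof -
  have "{(u, v). E u v} = Sigma V nb"
    using in_V by auto
  then show ?thesis
    using finite_V by (simp add: deg_def card_SigmaI)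
qed

lemma E_swap: "(\<lambda>x y. E y x) = E"
  using sym by blast

lemma gpath_rev: "gpath xs \<Longrightarrow> gpath (rev xs)"
  unfolding gpath_def successively_rev E_swap by simp

lemma gpath_Cons: "gpath (x # xs) \<longleftrightarrow> x \<in> V \<and> x \<notin> set xs \<and> gpath xs \<and> (xs = [] \<or> E x (hd xs))"
  by (auto simp: gpath_def successively_Cons)

lemma ex_longest_gpath:
  assumes "U \<subseteq> V" "U \<noteq> {}"
  obtains xs where "gpath xs" "set xs \<subseteq> U" "xs \<noteq> []"
    "\<And>ys. gpath ys \<Longrightarrow> set ys \<subseteq> U \<Longrightarrow> length ys \<le> length xs"
proof -
  obtain u where u: "u \<in> U" using assms by blast
  define P where "P xs \<longleftrightarrow> gpath xs \<and> set xs \<subseteq> U" for xs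
  have b: "length xs < Suc (card V)" if "P xs" for xs
    using that distinct_card[of xs] card_mono[OF finite_V, of "set xs"]
    by (auto simp: P_def gpath_def)
  have u1: "P [u]" using u assms by (auto simp: P_def gpath_def)
  obtain xs where xs: "P xs" "\<And>ys. P ys \<Longrightarrow> length ys \<le> length xs"
    using ex_has_greatest_nat[of P "[u]" length "Suc (card V)"] u1 b by blast
  moreover have "xs \<noteq> []" using xs(2)[OF u1] by auto
  ultimately show thesis using that unfolding P_def by blast
qed

text \<open>A neighbour of the first vertex that lies in \<open>U\<close> but off the path could be
  put in front of it, giving a longer path in \<open>U\<close>.\<close>

lemma longest_gpath_hd:
  assumes "gpath xs" "set xs \<subseteq> U" "xs \<noteq> []" "U \<subseteq> V"
    and "\<And>ys. gpath ys \<Longrightarrow> set ys \<subseteq> U \<Longrightarrow> length ys \<le> length xs"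
  shows "nb (hd xs) \<inter> U \<subseteq> set xs - {hd xs}"
proof
  fix w assume w: "w \<in> nb (hd xs) \<inter> U"
  have "w \<in> set xs"
  proof (rule ccontr)
    assume "w \<notin> set xs"
    then have "gpath (w # xs)" using w assms sym by (auto simp: gpath_Cons)
    from assms(5)[OF this] w assms(2) show False by auto
  qed
  with w not_self_nb show "w \<in> set xs - {hd xs}" by auto
qed

end

text \<open>Bounding the length of every path is the same as excluding paths on exactly
  \<open>k\<close> vertices, since an initial segment of a path is a path.\<close>

locale path_free_graph = ugraph +
  fixes k :: nat
  assumes path_free: "gpath xs \<Longrightarrow> length xs < k"
    and two_le_k: "2 \<le> k"
begin

text \<open>The first vertex of a longest path inside \<open>U\<close> has all its neighbours in
  \<open>U\<close> among the at most \<open>k - 2\<close> other vertices of the path. So the graph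
  is \<open>(k - 2)\<close>-degenerate.\<close>

lemma ex_low_degree_vertex:
  assumes "U \<subseteq> V" "U \<noteq> {}"
  shows "\<exists>v\<in>U. card (nb v \<inter> U) \<le> k - 2"
proof -
  obtain xs where xs: "gpath xs" "set xs \<subseteq> U" "xs \<noteq> []"
    "\<And>ys. gpath ys \<Longrightarrow> set ys \<subseteq> U \<Longrightarrow> length ys \<le> length xs"
    using ex_longest_gpath[OF assms] by blast
  have "card (nb (hd xs) \<inter> U) \<le> card (set xs - {hd xs})"
    using longest_gpath_hd[OF xs(1-3) assms(1) xs(4)] by (intro card_mono) auto
  also have "\<dots> = length xs - 1"
    using xs by (simp add: distinct_card gpath_def)
  also have "\<dots> \<le> k - 2" using path_free[OF xs(1)] by simp
  finally show ?thesis using xs(2,3) by (meson hd_in_set subsetD)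
qed

text \<open>Delete vertices one at a time, always one of degree at most \<open>k - 2\<close> in what
  is left. A deletion destroys at most \<open>k - 2\<close> edges; each counts at most once for its
  other end, and once more for the deleted vertex only if that lies in \<open>H\<close>.\<close>

lemma sum_deg_heavy:
  assumes "H \<subseteq> V"
  shows "(\<Sum>v\<in>H. deg v) \<le> (k - 2) * (card V + card H)"
proof -
  have "(\<Sum>v\<in>H \<inter> U. card (nb v \<inter> U)) \<le> (k - 2) * (card U + card (H \<inter> U))" if "U \<subseteq> V" for U
    using finite_subset[OF that finite_V] that
  proof (induction U rule: finite_psubset_induct)
    case (psubset U)
    show ?case
    proof (cases "U = {}")
      case False
      then obtain v where v: "v \<in> U" "card (nb v \<inter> U) \<le> k - 2"
        using ex_low_degree_vertex psubset.prems by blast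
      define U' where "U' = U - {v}"
      have U: "U = insert v U'" "v \<notin> U'" "finite U'" using v psubset.hyps by (auto simp: U'_def)
      have IH: "(\<Sum>w\<in>H \<inter> U'. card (nb w \<inter> U')) \<le> (k - 2) * (card U' + card (H \<inter> U'))"
        using psubset.IH[of U'] psubset.prems v(1) unfolding U'_def by blast
      have "(\<Sum>w\<in>H \<inter> U'. card (nb w \<inter> U)) = (\<Sum>w\<in>H \<inter> U'. card (nb w \<inter> U') + (if E v w then 1 else 0))"
      proof (rule sum.cong[OF refl])
        fix w assume "w \<in> H \<inter> U'"
        show "card (nb w \<inter> U) = card (nb w \<inter> U') + (if E v w then 1 else 0)"
        proof (cases "E v w")
          case True
          then have "nb w \<inter> U = insert v (nb w \<inter> U')" using U sym by auto
          then show ?thesis using True U by auto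
        next
          case False
          then have "nb w \<inter> U = nb w \<inter> U'" using U sym by auto
          then show ?thesis using False by auto
        qed
      qed
      also have "\<dots> = (\<Sum>w\<in>H \<inter> U'. card (nb w \<inter> U')) + card (H \<inter> U' \<inter> nb v)"
        using U(3) by (simp add: sum.distrib sum.If_cases Int_def nb_def conj_comms cong: conj_cong)
      also have "card (H \<inter> U' \<inter> nb v) \<le> card (nb v \<inter> U)"
        using U by (intro card_mono) auto
      also have "\<dots> \<le> k - 2" by (rule v(2))
      finally have *: "(\<Sum>w\<in>H \<inter> U'. card (nb w \<inter> U)) \<le> (k - 2) * (card U' + card (H \<inter> U')) + (k - 2)"
        using IH by linarith
      show ?thesis
      proof (cases "v \<in> H")
        case True
        then have h: "H \<inter> U = insert v (H \<inter> U')" using U by auto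
        have "(\<Sum>w\<in>H \<inter> U. card (nb w \<inter> U)) = card (nb v \<inter> U) + (\<Sum>w\<in>H \<inter> U'. card (nb w \<inter> U))"
          unfolding h using U by (simp add: U(1)[symmetric])
        moreover have "card (H \<inter> U) = Suc (card (H \<inter> U'))" "card U = Suc (card U')"
          unfolding h using U by auto
        ultimately show ?thesis using * v(2) by (simp add: algebra_simps)
      next
        case False
        then have h: "H \<inter> U = H \<inter> U'" using U by auto
        have "card U = Suc (card U')" using U by simp
        then show ?thesis unfolding h using * by (simp add: algebra_simps)
      qed
    qed auto
  qed
  from this[of V] have "(\<Sum>v\<in>H \<inter> V. card (nb v \<inter> V)) \<le> (k - 2) * (card V + card (H \<inter> V))" by simp
  moreover have "nb v \<inter> V = nb v" for v using nb_subset by blast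
  ultimately show ?thesis using assms by (simp add: deg_def Int_absorb2)
qed

text \<open>Each of these vertices adds at least \<open>d + 1\<close> to the sum bounded in
  \<open>sum_deg_heavy\<close>; solving for their number gives the claim. For
  \<open>d + 1 \<le> k - 2\<close> the truncated factor is \<open>0\<close>.\<close>

lemma card_heavy:
  "card {v \<in> V. deg v > d} * (d + 1 - (k - 2)) \<le> (k - 2) * card V"
proof -
  let ?H = "{v \<in> V. deg v > d}"
  have "card ?H * (d + 1) \<le> (\<Sum>v\<in>?H. deg v)"
    using sum_bounded_below[of ?H "d + 1" deg] by simp
  also have "\<dots> \<le> (k - 2) * (card V + card ?H)" by (rule sum_deg_heavy) auto
  finally show ?thesis by (simp add: algebra_simps diff_mult_distrib)
qed

text \<open>Either the ends of a longest path have few neighbours, or its vertex set carries a cycle, which by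
  maximality is a whole connected component.\<close>

lemma min_degree_dichotomy:
  "(\<exists>y\<in>V. deg y < k div 2) \<or> (\<forall>v\<in>V. deg v \<le> k - 2)"
proof (rule ccontr)
  assume "\<not> ?thesis"
  then obtain v0 where big: "\<And>y. y \<in> V \<Longrightarrow> deg y \<ge> k div 2" and v0: "v0 \<in> V" "deg v0 > k - 2"
    by (auto simp: not_less not_le)
  define C where "C = {w. (v0, w) \<in> {(u, v). E u v}\<^sup>*}"
  have C1: "v0 \<in> C" by (auto simp: C_def)
  have C2: "w \<in> C" if "u \<in> C" "E u w" for u w
    using that by (auto simp: C_def intro: rtrancl_into_rtrancl)
  have CV: "C \<subseteq> V"
  proof
    fix w assume "w \<in> C"
    then have "(v0, w) \<in> {(u, v). E u v}\<^sup>*" by (simp add: C_def)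
    then show "w \<in> V" by induction (use v0 in_V2 in auto)
  qed
  obtain xs where xs: "gpath xs" "set xs \<subseteq> C" "xs \<noteq> []"
    "\<And>ys. gpath ys \<Longrightarrow> set ys \<subseteq> C \<Longrightarrow> length ys \<le> length xs"
    using ex_longest_gpath[OF CV] C1 by blast
  let ?l = "length xs"
  let ?a = "hd xs" and ?b = "last xs"
  have dist: "distinct xs" and suc: "successively E xs" using xs(1) by (auto simp: gpath_def)
  have a: "nb ?a \<subseteq> set xs - {?a}"
    using longest_gpath_hd[OF xs(1-3) CV xs(4)] C2 xs(2,3) hd_in_set by fastforce
  have "nb (hd (rev xs)) \<inter> C \<subseteq> set (rev xs) - {hd (rev xs)}"
    using longest_gpath_hd[of "rev xs" C] gpath_rev[OF xs(1)] xs CV by auto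
  then have b: "nb ?b \<subseteq> set xs - {?b}"
    using C2 xs(2,3) last_in_set by (fastforce simp: hd_rev)
  \<comment> \<open>\<open>i \<in> A\<close> says that the vertex after position \<open>i\<close> is
    adjacent to the first vertex, \<open>i \<in> B\<close> that the vertex at position
    \<open>i\<close> is adjacent to the last. Both sets lie in \<open>{..<?l - 1}\<close> and have
    at least \<open>k div 2\<close> elements, too many to be disjoint.\<close>
  define A where "A = {i. Suc i < ?l \<and> E ?a (xs ! Suc i)}"
  define B where "B = {i. Suc i < ?l \<and> E ?b (xs ! i)}"
  have AB: "A \<union> B \<subseteq> {..<?l - 1}" by (auto simp: A_def B_def)
  then have fA: "finite A" and fB: "finite B" using finite_subset by auto
  have "nb ?a \<subseteq> (\<lambda>i. xs ! Suc i) ` A"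
  proof
    fix w assume w: "w \<in> nb ?a"
    then have "w \<in> set xs" "w \<noteq> xs ! 0" using a xs(3) by (auto simp: hd_conv_nth)
    then obtain i where i: "i < ?l" "w = xs ! i" "i \<noteq> 0"
      by (metis in_set_conv_nth)
    then show "w \<in> (\<lambda>i. xs ! Suc i) ` A" using w by (intro image_eqI[of _ _ "i - 1"]) (auto simp: A_def)
  qed
  then have cA: "deg ?a \<le> card A" unfolding deg_def
    using fA surj_card_le by blast
  have "nb ?b \<subseteq> (\<lambda>i. xs ! i) ` B"
  proof
    fix w assume w: "w \<in> nb ?b"
    then have "w \<in> set xs" "w \<noteq> xs ! (?l - 1)" using b xs(3) by (auto simp: last_conv_nth)
    then obtain i where i: "i < ?l" "w = xs ! i" "i \<noteq> ?l - 1"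
      by (metis in_set_conv_nth)
    then show "w \<in> (\<lambda>i. xs ! i) ` B" using w by (intro image_eqI[of _ _ i]) (auto simp: B_def)
  qed
  then have cB: "deg ?b \<le> card B" unfolding deg_def
    using fB surj_card_le by blast
  have "A \<inter> B \<noteq> {}"
  proof
    assume "A \<inter> B = {}"
    with fA fB have "card A + card B = card (A \<union> B)" by (simp add: card_Un_disjoint)
    also have "\<dots> \<le> ?l - 1" using card_mono[OF _ AB] by simp
    finally have "deg ?a + deg ?b \<le> ?l - 1" using cA cB by linarith
    moreover have "deg ?a \<ge> k div 2" "deg ?b \<ge> k div 2"
      using big[of ?a] big[of ?b] xs(2,3) CV hd_in_set last_in_set by blast+
    ultimately show False using path_free[OF xs(1)] two_le_k xs(3) by simp
  qed
  then obtain i where i: "Suc i < ?l" "E ?a (xs ! Suc i)" "E ?b (xs ! i)"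
    by (auto simp: A_def B_def)
  \<comment> \<open>Follow the path up to position \<open>i\<close>, jump to its end, go backwards
    to position \<open>Suc i\<close> and return to the start: this is a cycle through all vertices
    of \<open>xs\<close>.\<close>
  define p where "p = take (Suc i) xs"
  define q where "q = drop (Suc i) xs"
  have pq: "xs = p @ q" "p \<noteq> []" "q \<noteq> []" "last p = xs ! i" "hd q = xs ! Suc i"
    "hd p = ?a" "last q = ?b"
    using i(1) xs(3)
    by (simp_all add: p_def q_def hd_drop_conv_nth last_conv_nth[of "take _ _"] min_def)
  define c where "c = p @ rev q"
  have rq: "successively E p" "successively E (rev q)" using suc unfolding pq(1)
    successively_append_iff successively_rev E_swap by auto
  have seam: "E (last p) (last q)" "E (hd q) (hd p)" using i(2,3) sym unfolding pq(4-7) by blast+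
  have c: "distinct c" "set c = set xs" "length c = ?l" "successively E c" "E (last c) (hd c)" "c \<noteq> []"
  proof -
    show "distinct c" "set c = set xs" "length c = ?l" "c \<noteq> []"
      using dist pq(2) unfolding c_def pq(1) by auto
    show "successively E c" "E (last c) (hd c)"
      using rq seam pq(2,3) by (simp_all add: c_def successively_append_iff hd_rev last_rev del: successively_rev)
  qed
  \<comment> \<open>Otherwise some edge leaves the cycle. Opening the cycle at the end of that edge
    gives a path in \<open>C\<close> with one vertex more than \<open>xs\<close>.\<close>
  have "C \<subseteq> set xs"
  proof (rule ccontr)
    assume "\<not> C \<subseteq> set xs"
    have "\<exists>x\<in>set xs. \<exists>w. w \<notin> set xs \<and> E x w"
    proof (rule ccontr)
      assume no: "\<not> ?thesis"
      have step: "w \<in> set xs" if "(v, w) \<in> {(u, v). E u v}\<^sup>*" "v \<in> set xs" for v w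
        using that by induction (use no in auto)
      have "symp E" using sym by (auto simp: symp_def)
      then have "sym {(u, v). E u v}" by (auto simp: sym_def symp_def)
      then have s: "sym ({(u, v). E u v}\<^sup>*)" by (rule sym_rtrancl)
      have "?a \<in> C" using xs(2,3) by auto
      then have "(?a, v0) \<in> {(u, v). E u v}\<^sup>*" using s by (auto simp: C_def dest: symD)
      then have "v0 \<in> set xs" using step xs(3) by simp
      then have "C \<subseteq> set xs" using step by (auto simp: C_def)
      with \<open>\<not> C \<subseteq> set xs\<close> show False by simp
    qed
    then obtain x w where xw: "x \<in> set c" "w \<notin> set xs" "E x w" using c(2) by auto
    then obtain c1 c2 where c12: "c = c1 @ x # c2" by (meson split_list)
    have "E (last c2) (hd c1)" if "c1 \<noteq> []" "c2 \<noteq> []" using c(5) c12 that by auto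
    moreover have "E x (hd c1)" if "c1 \<noteq> []" "c2 = []" using c(5) c12 that by auto
    ultimately have "successively E (x # c2 @ c1)" using c(4) unfolding c12
      by (cases "c2 = []") (auto simp: successively_append_iff successively_Cons)
    then have "gpath (w # x # c2 @ c1)"
      using c(1,2) xw in_V2 sym xs(1) unfolding c12 gpath_def by (auto simp: successively_Cons)
    moreover have "set (w # x # c2 @ c1) \<subseteq> C"
      using c(2) xw C2 xs(2) unfolding c12 by auto
    ultimately have "length (w # x # c2 @ c1) \<le> ?l" by (rule xs(4))
    then show False using c(3) c12 by simp
  qed
  \<comment> \<open>So \<open>v0\<close> and its more than \<open>k - 2\<close> neighbours all lie
    on one path, which has fewer than \<open>k\<close> vertices.\<close>
  moreover have "insert v0 (nb v0) \<subseteq> C" using C1 C2 by auto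
  ultimately have "card (insert v0 (nb v0)) \<le> card (set xs)"
    by (intro card_mono) auto
  then have "Suc (deg v0) \<le> length xs"
    using dist by (simp add: distinct_card deg_def irrefl)
  then show False using path_free[OF xs(1)] v0(2) by simp
qed

text \<open>The vertices of \<open>vs\<close> are strung together by fresh common neighbours outside
  \<open>vs\<close>. At most \<open>length vs\<close> connecting vertices are ever in use, so one is
  always free. The case \<open>v = v'\<close> provides the outer vertices at both ends.\<close>

lemma gpath_through:
  assumes "distinct vs" "vs \<noteq> []" "set vs \<subseteq> V"
    and "\<And>v v'. v \<in> set vs \<Longrightarrow> v' \<in> set vs \<Longrightarrow> card (nb v \<inter> nb v' - set vs) > length vs"
  shows "2 * length vs + 1 < k"
proof -
  \<comment> \<open>The path is built from its back end: it starts at \<open>hd ws\<close>,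
    alternates between \<open>ws\<close> and connecting vertices, and ends with one of the
    latter.\<close>
  have "\<exists>xs. gpath xs \<and> length xs = 2 * length ws \<and> hd xs = hd ws \<and> set ws \<subseteq> set xs
      \<and> set xs \<inter> set vs \<subseteq> set ws"
    if "distinct ws" "set ws \<subseteq> set vs" "ws \<noteq> []" for ws
    using that
  proof (induction ws)
    case (Cons v ws)
    have v: "v \<in> set vs" "v \<in> V" using Cons.prems assms(3) by auto
    show ?case
    proof (cases "ws = []")
      case True
      have "nb v - set vs \<noteq> {}" using assms(4)[OF v(1) v(1)] by force
      then obtain u where "u \<in> nb v" "u \<notin> set vs" by blast
      then have u: "E v u" "u \<notin> set vs" by auto
      then have "gpath [v, u]" using v in_V2 by (auto simp: gpath_Cons gpath_def)
      then show ?thesis using True u by (intro exI[of _ "[v, u]"]) auto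
    next
      case False
      then obtain xs where xs: "gpath xs" "length xs = 2 * length ws" "hd xs = hd ws"
        "set ws \<subseteq> set xs" "set xs \<inter> set vs \<subseteq> set ws" using Cons by auto
      have h: "hd ws \<in> set vs" using False Cons.prems by auto
      have "card (set xs - set vs) \<le> card (set xs - set ws)"
        using Cons.prems by (intro card_mono) auto
      also have "\<dots> = length ws"
        using xs Cons.prems by (simp add: card_Diff_subset distinct_card gpath_def)
      also have "length ws = card (set ws)" using Cons.prems by (simp add: distinct_card)
      also have "\<dots> \<le> card (set vs)" using Cons.prems by (intro card_mono) auto
      also have "\<dots> = length vs" using assms(1) by (rule distinct_card)
      finally have "card (set xs - set vs) < card (nb v \<inter> nb (hd ws) - set vs)"
        using assms(4)[OF v(1) h] by simp
      then have "\<not> nb v \<inter> nb (hd ws) - set vs \<subseteq> set xs - set vs"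
        using card_mono[of "set xs - set vs"] by (meson List.finite_set finite_Diff leD)
      then obtain u where u: "E v u" "E (hd ws) u" "u \<notin> set vs" "u \<notin> set xs"
        unfolding nb_def by blast
      have "xs \<noteq> []" using xs(2) False by auto
      then have "gpath (v # u # xs)"
        using u v xs Cons.prems sym in_V2 by (auto simp: gpath_Cons)
      then show ?thesis using xs u by (intro exI[of _ "v # u # xs"]) auto
    qed
  qed simp
  \<comment> \<open>One more fresh neighbour in front of \<open>hd vs\<close> raises the number of
    vertices to \<open>2 * length vs + 1\<close>.\<close>
  from this[of vs] assms obtain xs where xs: "gpath xs" "length xs = 2 * length vs" "hd xs = hd vs"
    "set vs \<subseteq> set xs" by auto
  have h: "hd vs \<in> set vs" using assms by auto
  have "card (set xs - set vs) = length vs"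
    using xs assms by (simp add: card_Diff_subset distinct_card gpath_def)
  then have "card (set xs - set vs) < card (nb (hd vs) \<inter> nb (hd vs) - set vs)"
    using assms(4)[OF h h] by simp
  then have "\<not> nb (hd vs) \<inter> nb (hd vs) - set vs \<subseteq> set xs - set vs"
    using card_mono[of "set xs - set vs"] by (meson List.finite_set finite_Diff leD)
  then obtain u where u: "E (hd vs) u" "u \<notin> set vs" "u \<notin> set xs"
    unfolding nb_def by blast
  then have "gpath (u # xs)" using xs sym in_V2 by (auto simp: gpath_Cons)
  from path_free[OF this] show ?thesis using xs by simp
qed

text \<open>By inclusion and exclusion any two such vertices have at least \<open>k + 1\<close>
  common neighbours. So \<open>k div 2\<close> of them would lie on a path with
  \<open>2 * (k div 2) + 1 \<ge> k\<close> vertices.\<close>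

lemma card_very_heavy:
  "card {v \<in> V. card V + k + 1 \<le> 2 * deg v} < k div 2"
proof (rule ccontr)
  let ?H = "{v \<in> V. card V + k + 1 \<le> 2 * deg v}"
  assume "\<not> ?thesis"
  then have "k div 2 \<le> card ?H" by simp
  then obtain A where A: "A \<subseteq> ?H" "card A = k div 2" "finite A"
    by (rule obtain_subset_with_card_n)
  then obtain vs where vs: "set vs = A" "distinct vs" using finite_distinct_list by blast
  then have l: "length vs = k div 2" using A(2) distinct_card by force
  have "length vs < card (nb v \<inter> nb v' - set vs)" if "v \<in> set vs" "v' \<in> set vs" for v v'
  proof -
    have "card (nb v \<union> nb v') + card (nb v \<inter> nb v') = deg v + deg v'"
      using card_Un_Int[of "nb v" "nb v'"] by (simp add: deg_def)
    moreover have "card (nb v \<union> nb v') \<le> card V" using nb_subset finite_V by (intro card_mono) auto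
    moreover have "card V + k + 1 \<le> 2 * deg v" "card V + k + 1 \<le> 2 * deg v'" using that vs A by auto
    ultimately have "k + 1 \<le> card (nb v \<inter> nb v')" by linarith
    moreover have "card (nb v \<inter> nb v') - card (set vs) \<le> card (nb v \<inter> nb v' - set vs)"
      by (rule diff_card_le_card_Diff) simp
    moreover have "card (set vs) = k div 2" using vs A by simp
    ultimately show ?thesis using l by linarith
  qed
  moreover have "vs \<noteq> []" using l two_le_k by auto
  ultimately have "2 * length vs + 1 < k" using vs A by (intro gpath_through) auto
  then show False using l by linarith
qed

text \<open>A complete bipartite graph with \<open>k div 2\<close> vertices on one side and more on
  the other contains an alternating path on at least \<open>k\<close> vertices.\<close>

lemma card_common_nb:
  assumes "card A = k div 2" "A \<subseteq> V" "\<And>v y. v \<in> A \<Longrightarrow> y \<in> Y \<Longrightarrow> E v y"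
  shows "card Y \<le> k div 2"
proof (rule ccontr)
  assume c: "\<not> ?thesis"
  have fA: "finite A" using assms(2) finite_V finite_subset by blast
  then obtain vs where vs: "set vs = A" "distinct vs" using finite_distinct_list by blast
  then have l: "length vs = k div 2" using assms(1) distinct_card by force
  then have ne: "vs \<noteq> []" using two_le_k by auto
  have "Y \<inter> A = {}" using assms(3) irrefl by blast
  have "length vs < card (nb v \<inter> nb v' - set vs)" if "v \<in> set vs" "v' \<in> set vs" for v v'
  proof -
    have "Y \<subseteq> nb v \<inter> nb v' - set vs" using that vs assms(3) \<open>Y \<inter> A = {}\<close> by auto
    then have "card Y \<le> card (nb v \<inter> nb v' - set vs)" by (intro card_mono) auto
    then show ?thesis using c l by simp
  qed
  from gpath_through[OF vs(2) ne _ this] vs assms(2) l show False by auto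
qed

end

section \<open>Independent sets, greedy placement and rooted trees\<close>

context ugraph
begin

text \<open>Turan's bound in terms of the degree sum. Remove a vertex of minimum degree together
  with its neighbours, a set \<open>B\<close>. All degrees in \<open>B\<close> are at least
  \<open>card B - 1\<close>, so degree sum plus size drops by at least \<open>card B ^ 2\<close>;
  the Cauchy-Schwarz inequality combines this with the bound for the rest.\<close>

lemma turan:
  assumes "S \<subseteq> V"
  shows "\<exists>A\<subseteq>S. (\<forall>u\<in>A. \<forall>v\<in>A. \<not> E u v) \<and> card S ^ 2 \<le> card A * ((\<Sum>v\<in>S. card (nb v \<inter> S)) + card S)"
  using finite_subset[OF assms finite_V] assms
proof (induction S rule: finite_psubset_induct)
  case (psubset S)
  show ?case
  proof (cases "S = {}")
    case False
    define dd where "dd v = card (nb v \<inter> S)" for v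
    obtain v where v: "v \<in> S" "\<And>w. w \<in> S \<Longrightarrow> dd v \<le> dd w"
      using ex_min_if_finite[of "dd ` S"] psubset.hyps False
      by (metis (mono_tags, lifting) arg_min_if_finite(1) arg_min_if_finite(2) not_le)
    define B where "B = insert v (nb v \<inter> S)"
    define S' where "S' = S - B"
    have B: "B \<subseteq> S" "finite B" "card B = Suc (dd v)"
      using v psubset.hyps irrefl by (auto simp: B_def dd_def finite_subset)
    have "S' \<subset> S" using v by (auto simp: S'_def B_def)
    then obtain A where A: "A \<subseteq> S'" "\<forall>u\<in>A. \<forall>v\<in>A. \<not> E u v"
      "card S' ^ 2 \<le> card A * ((\<Sum>v\<in>S'. card (nb v \<inter> S')) + card S')"
      using psubset.IH[of S'] psubset.prems by blast
    have fA: "finite A" using A(1) psubset.hyps by (auto simp: S'_def intro: finite_subset)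
    have vA: "v \<notin> A" using A(1) by (auto simp: S'_def B_def)
    have indep: "\<forall>u\<in>insert v A. \<forall>w\<in>insert v A. \<not> E u w"
      using A(1,2) irrefl sym by (auto simp: S'_def B_def)
    define x where "x = real (card B)"
    define y where "y = real (card S')"
    define s where "s = real ((\<Sum>v\<in>S'. card (nb v \<inter> S')) + card S')"
    define t where "t = real ((\<Sum>v\<in>S. dd v) + card S)"
    have cS: "card S = card B + card S'"
      using B card_mono[OF psubset.hyps B(1)] unfolding S'_def by (simp add: card_Diff_subset)
    have "(\<Sum>w\<in>S. dd w) = (\<Sum>w\<in>B. dd w) + (\<Sum>w\<in>S'. dd w)"
      using B psubset.hyps unfolding S'_def by (simp add: sum.subset_diff add.commute)
    moreover have "card B * dd v \<le> (\<Sum>w\<in>B. dd w)"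
      using sum_bounded_below[of B "dd v" dd] v(2) B(1) by auto
    moreover have "(\<Sum>v\<in>S'. card (nb v \<inter> S')) \<le> (\<Sum>w\<in>S'. dd w)"
      using psubset.hyps by (intro sum_mono) (auto simp: dd_def S'_def intro!: card_mono)
    ultimately have "card B * card B + ((\<Sum>v\<in>S'. card (nb v \<inter> S')) + card S') \<le> (\<Sum>w\<in>S. dd w) + card S"
      using cS B(3) by (simp add: algebra_simps)
    then have "real (card B * card B + ((\<Sum>v\<in>S'. card (nb v \<inter> S')) + card S')) \<le> t"
      unfolding t_def by (simp only: of_nat_le_iff)
    then have xs: "x * x + s \<le> t" unfolding x_def s_def by simp
    have ys: "y ^ 2 \<le> card A * s"
      using A(3) unfolding y_def s_def by (metis of_nat_le_iff of_nat_mult of_nat_power)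
    \<comment> \<open>The square behind the Cauchy-Schwarz inequality, written without division
      because \<open>card A\<close> may be \<open>0\<close>.\<close>
    have a0: "(x * card A - y) ^ 2 \<ge> 0" by simp
    have "(x + y) ^ 2 \<le> (1 + card A) * (x * x + s)"
    proof (cases "card A = 0")
      case True
      then have "y = 0" using ys by simp
      moreover have "0 \<le> s" by (simp add: s_def sum_nonneg)
      ultimately show ?thesis using True by (simp add: power2_eq_square)
    next
      case False
      have "2 * x * y * card A \<le> card A * (x * x * card A) + y ^ 2"
        using a0 by (simp add: power2_eq_square algebra_simps)
      also have "\<dots> \<le> card A * (x * x * card A) + card A * s" using ys by simp
      finally have "card A * (2 * x * y) \<le> card A * (x * x * card A + s)"
        by (simp add: algebra_simps)
      then have "2 * x * y \<le> x * x * card A + s" using False by simp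
      then show ?thesis using ys by (simp add: power2_eq_square algebra_simps)
    qed
    also have "\<dots> \<le> (1 + card A) * t" using xs by (intro mult_left_mono) auto
    finally have "(x + y) ^ 2 \<le> card (insert v A) * t" using fA vA by simp
    then have "real (card S ^ 2) \<le> real (card (insert v A) * ((\<Sum>v\<in>S. dd v) + card S))"
      unfolding x_def y_def t_def cS by simp
    then have "card S ^ 2 \<le> card (insert v A) * ((\<Sum>v\<in>S. card (nb v \<inter> S)) + card S)"
      unfolding dd_def by (simp only: of_nat_le_iff)
    moreover have "insert v A \<subseteq> S" using A(1) v(1) by (auto simp: S'_def)
    ultimately show ?thesis using indep by (intro exI[of _ "insert v A"] conjI)
  qed auto
qed

end

text \<open>The vertices are placed in order of increasing depth. When \<open>v\<close> is placed,
  its parent is the only neighbour that can already be there; it blocks at most \<open>d\<close>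
  values of \<open>T v\<close>, and fewer than \<open>card U\<close> values are taken. The target
  sets \<open>T v\<close> allow for constraints from vertices placed before.\<close>

lemma greedy_embedding:
  fixes E :: "'a \<Rightarrow> 'a \<Rightarrow> bool" and r :: "'b \<Rightarrow> 'b \<Rightarrow> bool" and depth :: "'a \<Rightarrow> nat"
  assumes "ugraph VR r" "finite U"
    and "\<And>u v. E u v \<Longrightarrow> E v u"
    and "\<And>v. \<not> E v v"
    and "\<And>u v. u \<in> U \<Longrightarrow> v \<in> U \<Longrightarrow> E u v \<Longrightarrow>
      (u = par v \<and> depth u < depth v) \<or> (v = par u \<and> depth v < depth u)"
    and "\<And>v. v \<in> U \<Longrightarrow> finite (T v) \<and> card U + d \<le> card (T v)"
    and "\<And>v y. v \<in> U \<Longrightarrow> y \<in> T v \<Longrightarrow> ugraph.deg r y \<le> d"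
  shows "\<exists>f. inj_on f U \<and> (\<forall>v\<in>U. f v \<in> T v) \<and> (\<forall>u\<in>U. \<forall>v\<in>U. E u v \<longrightarrow> \<not> r (f u) (f v))"
  using assms(2,5-)
proof (induction "card U" arbitrary: U)
  case 0
  then show ?case by auto
next
  case (Suc c)
  interpret R: ugraph VR r by fact
  have ne: "U \<noteq> {}" using Suc.hyps(2) by auto
  obtain v where v: "v \<in> U" "\<And>w. w \<in> U \<Longrightarrow> depth w \<le> depth v"
  proof -
    have "Max (depth ` U) \<in> depth ` U" using Suc.prems(1) ne by (intro Max_in) auto
    then obtain v where "v \<in> U" "depth v = Max (depth ` U)" by auto
    then show thesis using that[of v] Suc.prems(1) by simp
  qed
  define U' where "U' = U - {v}"
  have cU': "card U' = c" using v(1) Suc.hyps(2) Suc.prems(1) by (simp add: U'_def)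
  have "\<exists>f. inj_on f U' \<and> (\<forall>v\<in>U'. f v \<in> T v) \<and> (\<forall>u\<in>U'. \<forall>v\<in>U'. E u v \<longrightarrow> \<not> r (f u) (f v))"
  proof (rule Suc.hyps(1))
    show "finite (T w) \<and> card U' + d \<le> card (T w)" if "w \<in> U'" for w
      using Suc.prems(3)[of w] that cU' Suc.hyps(2) by (auto simp: U'_def)
  qed (use Suc.prems cU' in \<open>auto simp: U'_def\<close>)
  then obtain f where f: "inj_on f U'" "\<And>v. v \<in> U' \<Longrightarrow> f v \<in> T v"
    "\<And>u v. u \<in> U' \<Longrightarrow> v \<in> U' \<Longrightarrow> E u v \<Longrightarrow> \<not> r (f u) (f v)" by blast
  \<comment> \<open>The parent may lie outside \<open>U\<close>; then it blocks nothing
    here.\<close>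
  define X where "X = (if par v \<in> U' then R.nb (f (par v)) else {})"
  have X: "finite X" "card X \<le> d"
    using f(2)[of "par v"] Suc.prems(4)[of "par v"] by (auto simp: X_def R.deg_def U'_def)
  have "card (f ` U' \<union> X) \<le> c + d"
    using card_Un_le[of "f ` U'" X] card_image_le[of U' f] Suc.prems(1) X(2) cU'
    by (auto simp: U'_def)
  then have "card (f ` U' \<union> X) < card (T v)" using Suc.prems(3)[OF v(1)] Suc.hyps(2) by linarith
  moreover have "finite (f ` U' \<union> X)" using X Suc.prems(1) by (auto simp: U'_def)
  ultimately obtain y where y: "y \<in> T v" "y \<notin> f ` U'" "y \<notin> X"
    by (metis UnCI card_mono not_less subsetI)
  have par: "w = par v" if "w \<in> U'" "E v w" for w
    using Suc.prems(2)[of v w] v that by (fastforce simp: U'_def)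
  have nr: "\<not> r y (f w)" if "w \<in> U'" "E v w" for w
    using y(3) par[OF that] that R.sym by (auto simp: X_def)
  define g where "g = f(v := y)"
  have vU': "v \<notin> U'" by (simp add: U'_def)
  have U: "U = insert v U'" using v(1) by (auto simp: U'_def)
  have "inj_on g U" unfolding U using f(1) y(2) vU' by (auto simp: g_def inj_on_def)
  moreover have "\<forall>v\<in>U. g v \<in> T v" unfolding U using f(2) y(1) vU' by (auto simp: g_def)
  moreover have "\<not> r (g u) (g w)" if "u \<in> U" "w \<in> U" "E u w" for u w
    using that f(3)[of u w] nr[of u] nr[of w] vU' assms(3)[OF that(3)] assms(4) R.sym
    unfolding U g_def by auto
  ultimately show ?case by blast
qed

text \<open>Choosing a vertex and discarding it with its neighbours uses up at most
  \<open>d + 1\<close> vertices of \<open>S\<close>.\<close>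

lemma (in ugraph) ex_independent_subset:
  assumes "finite S" "\<And>v. v \<in> S \<Longrightarrow> deg v \<le> d" "q * (d + 1) \<le> card S"
  shows "\<exists>A\<subseteq>S. card A = q \<and> (\<forall>u\<in>A. \<forall>v\<in>A. \<not> E u v)"
  using assms
proof (induction q arbitrary: S)
  case (Suc q)
  then have "S \<noteq> {}" by auto
  then obtain v where v: "v \<in> S" by blast
  define S' where "S' = S - insert v (nb v)"
  have "card S - card (insert v (nb v)) \<le> card S'"
    unfolding S'_def by (rule diff_card_le_card_Diff) simp
  moreover have "card (insert v (nb v)) \<le> d + 1" using Suc.prems(2)[OF v] by (simp add: deg_def irrefl)
  ultimately have "q * (d + 1) \<le> card S'" using Suc.prems(3) by simp
  then obtain A where A: "A \<subseteq> S'" "card A = q" "\<forall>u\<in>A. \<forall>v\<in>A. \<not> E u v"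
    using Suc.IH[of S'] Suc.prems(1,2) by (auto simp: S'_def)
  have "finite A" using A(1) Suc.prems(1) by (auto simp: S'_def intro: finite_subset)
  moreover have "v \<notin> A" using A(1) by (auto simp: S'_def)
  moreover have "\<not> E v u" "\<not> E u v" if "u \<in> A" for u using A(1) that sym by (auto simp: S'_def)
  ultimately show ?case using A v irrefl by (intro exI[of _ "insert v A"]) (auto simp: S'_def)
qed auto

section \<open>Breadth-first spanning trees and non-tree edges\<close>

locale rooted_graph = ugraph +
  fixes root :: 'a and par :: "'a \<Rightarrow> 'a" and depth :: "'a \<Rightarrow> nat"
  assumes root_in: "root \<in> V"
    and E_par: "v \<in> V \<Longrightarrow> v \<noteq> root \<Longrightarrow> E v (par v)"
    and depth_par: "v \<in> V \<Longrightarrow> v \<noteq> root \<Longrightarrow> depth v = Suc (depth (par v))"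
    and depth_root: "v \<in> V \<Longrightarrow> depth v = 0 \<longleftrightarrow> v = root"
    and depth_edge: "E u v \<Longrightarrow> depth v \<le> Suc (depth u)"

text \<open>The depth is the distance from an arbitrary root, and the parent is the last vertex but
  one on a shortest walk from the root.\<close>

lemma (in ugraph) ex_rooted_graph:
  assumes "\<And>u v. u \<in> V \<Longrightarrow> v \<in> V \<Longrightarrow> (u, v) \<in> {(u, v). E u v}\<^sup>*" "V \<noteq> {}"
  shows "\<exists>root par depth. rooted_graph V E root par depth"
proof -
  obtain root where root: "root \<in> V" using assms(2) by blast
  define A where "A = {(u, v). E u v}"
  define depth where "depth v = (LEAST i. (root, v) \<in> A ^^ i)" for v
  have ex: "\<exists>i. (root, v) \<in> A ^^ i" if "v \<in> V" for v
    using assms(1)[OF root that] rtrancl_imp_relpow unfolding A_def by blast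
  have depth: "(root, v) \<in> A ^^ depth v" if "v \<in> V" for v
    unfolding depth_def using ex[OF that] by (rule LeastI_ex)
  have le: "depth v \<le> i" if "(root, v) \<in> A ^^ i" for v i
    unfolding depth_def using that by (rule Least_le)
  have "depth root \<le> 0" by (rule le) simp
  then have d0: "depth root = 0" by simp
  have d1: "v = root" if "v \<in> V" "depth v = 0" for v using depth[OF that(1)] that(2) by simp
  have edge: "depth v \<le> Suc (depth u)" if "E u v" for u v
    using le[of v "Suc (depth u)"] depth[OF in_V[OF that]] that by (auto simp: A_def)
  have "\<exists>w. E v w \<and> depth v = Suc (depth w)" if v: "v \<in> V" "v \<noteq> root" for v
  proof -
    obtain i where i: "depth v = Suc i" using d1 v by (cases "depth v") auto
    then obtain w where w: "(root, w) \<in> A ^^ i" "(w, v) \<in> A" using depth[OF v(1)] by auto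
    then have "E w v" by (simp add: A_def)
    then show ?thesis using le[OF w(1)] edge[of w v] i sym by (intro exI[of _ w]) auto
  qed
  then obtain par where par: "\<And>v. v \<in> V \<Longrightarrow> v \<noteq> root \<Longrightarrow> E v (par v) \<and> depth v = Suc (depth (par v))"
    by metis
  have "rooted_graph V E root par depth"
  proof (intro rooted_graph.intro rooted_graph_axioms.intro ugraph_axioms)
    show "depth v = 0 \<longleftrightarrow> v = root" if "v \<in> V" for v using d0 d1[OF that] by blast
  qed (use root par edge in blast)+
  then show ?thesis by blast
qed

context rooted_graph
begin

text \<open>The ends of the non-tree edges. The comparisons with \<open>root\<close> are there
  because \<open>par root\<close> is an arbitrary value.\<close>

definition core :: "'a set" where
  "core = {v. \<exists>u. E v u \<and> \<not> (v \<noteq> root \<and> u = par v) \<and> \<not> (u \<noteq> root \<and> v = par u)}"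

lemma core_subset: "core \<subseteq> V"
  using in_V by (auto simp: core_def)

lemma tree_edge:
  assumes "E u v" "u \<notin> core"
  shows "(v \<noteq> root \<and> u = par v \<and> depth u < depth v) \<or> (u \<noteq> root \<and> v = par u \<and> depth v < depth u)"
proof -
  have "(u \<noteq> root \<and> v = par u) \<or> (v \<noteq> root \<and> u = par v)"
    using assms unfolding core_def by blast
  then show ?thesis
  proof (elim disjE conjE)
    assume "u \<noteq> root" "v = par u"
    then show ?thesis using depth_par[OF in_V[OF assms(1)]] by simp
  next
    assume "v \<noteq> root" "u = par v"
    then show ?thesis using depth_par[OF in_V2[OF assms(1)]] by simp
  qed
qed

text \<open>The degree sum counts both orientations of the \<open>card V - 1\<close> tree edges, and
  every vertex of \<open>core\<close> is the first end of a further arc.\<close>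

lemma card_core: "card core + 2 * (card V - 1) \<le> (\<Sum>v\<in>V. deg v)"
proof -
  let ?A = "{(u, v). E u v}"
  let ?T = "(\<lambda>v. (v, par v)) ` (V - {root})"
  let ?S = "(\<lambda>v. (par v, v)) ` (V - {root})"
  have fin: "finite ?A" using finite_V in_V in_V2 by (intro finite_subset[of ?A "V \<times> V"]) auto
  have "?T \<inter> ?S = {}"
  proof -
    have False if "v \<in> V" "v \<noteq> root" "w \<in> V" "w \<noteq> root" "v = par w" "par v = w" for v w
      using depth_par[of v] depth_par[of w] that by simp
    then show ?thesis by auto
  qed
  then have "card (?T \<union> ?S) = card ?T + card ?S"
    using finite_V by (intro card_Un_disjoint) auto
  also have "card ?T = card V - 1" using root_in by (subst card_image) (auto simp: inj_on_def)
  also have "card ?S = card V - 1" using root_in by (subst card_image) (auto simp: inj_on_def)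
  finally have c: "card (?T \<union> ?S) = 2 * (card V - 1)" by simp
  have sub: "?T \<union> ?S \<subseteq> ?A" using E_par sym by auto
  have "core \<subseteq> fst ` (?A - (?T \<union> ?S))"
  proof
    fix v assume "v \<in> core"
    then obtain u where "E v u" "\<not> (v \<noteq> root \<and> u = par v)" "\<not> (u \<noteq> root \<and> v = par u)"
      by (auto simp: core_def)
    then have "(v, u) \<in> ?A - (?T \<union> ?S)" by auto
    then show "v \<in> fst ` (?A - (?T \<union> ?S))" by force
  qed
  then have "card core \<le> card (?A - (?T \<union> ?S))"
    using surj_card_le[of "?A - (?T \<union> ?S)" core fst] fin by blast
  also have "\<dots> = card ?A - 2 * (card V - 1)"
    using c sub fin by (subst card_Diff_subset) (auto intro: finite_subset)
  finally have "card core \<le> card ?A - 2 * (card V - 1)" .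
  moreover have "2 * (card V - 1) \<le> card ?A" using c card_mono[OF fin sub] by simp
  ultimately show ?thesis unfolding sum_deg by linarith
qed

text \<open>The only edge of a leaf other than the root leads to its parent. If the root is a leaf,
  its neighbour has depth 1 by \<open>depth_edge\<close>, so the root is that neighbour's
  parent.\<close>

lemma leaf_notin_core:
  assumes "nb v = {w}"
  shows "v \<notin> core"
proof
  assume "v \<in> core"
  then obtain u where u: "E v u" "\<not> (v \<noteq> root \<and> u = par v)" "\<not> (u \<noteq> root \<and> v = par u)"
    by (auto simp: core_def)
  have only: "x = w" if "E v x" for x using that assms in_nb by blast
  show False
  proof (cases "v = root")
    case False
    then show ?thesis using u E_par[of v] only in_V by metis
  next
    case True
    have "u \<noteq> root" using u True irrefl by auto
    moreover have "depth u \<le> 1" using depth_edge[OF u(1)] depth_root[of v] True root_in by simp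
    ultimately have "depth (par u) = 0" using depth_par[of u] in_V2[OF u(1)] by simp
    moreover have "par u \<in> V" using E_par[of u] in_V2 u(1) \<open>u \<noteq> root\<close> by blast
    ultimately have "par u = root" using depth_root by blast
    then show ?thesis using u True \<open>u \<noteq> root\<close> by auto
  qed
qed

lemma deg_pos:
  assumes "v \<in> V" "2 \<le> card V"
  shows "0 < deg v"
proof -
  have "nb v \<noteq> {}"
  proof (cases "v = root")
    case False
    then show ?thesis using E_par[OF assms(1)] in_nb by blast
  next
    case True
    have ne: "V - {root} \<noteq> {}"
    proof
      assume "V - {root} = {}"
      then have "card V \<le> card {root}" by (intro card_mono) auto
      then show False using assms(2) by simp
    qed
    obtain u where u: "u \<in> V - {root}" "\<And>w. w \<in> V - {root} \<Longrightarrow> depth u \<le> depth w"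
      using ex_has_least_nat[of "\<lambda>u. u \<in> V - {root}" _ depth] ne by blast
    have "par u = root"
    proof (rule ccontr)
      assume "par u \<noteq> root"
      then have "depth u \<le> depth (par u)" using u E_par[of u] in_V2 by blast
      then show False using depth_par[of u] u by simp
    qed
    then have "E v u" using E_par[of u] u sym True by auto
    then show ?thesis by auto
  qed
  then show ?thesis by (simp add: deg_def card_gt_0_iff)
qed

text \<open>Two adjacent leaves would be cut off from the rest: a further vertex of least depth
  would have one of them as its parent. So all leaves can be set aside at once without losing the
  neighbour of a leaf.\<close>

lemma leaf_nb_not_leaf:
  assumes "nb v = {w}" "3 \<le> card V"
  shows "deg w \<noteq> 1"
proof
  assume "deg w = 1"
  moreover have "v \<in> nb w" using assms sym in_nb by blast
  ultimately have w: "nb w = {v}" unfolding deg_def by (metis card_1_singletonE singletonD)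
  have "V \<subseteq> {v, w}"
  proof (rule ccontr)
    assume "\<not> V \<subseteq> {v, w}"
    moreover have "root \<in> {v, w}"
    proof (rule ccontr)
      assume n: "root \<notin> {v, w}"
      have vw: "v \<in> V" "w \<in> V" using nb_subset[of v] nb_subset[of w] unfolding assms(1) w by simp_all
      have "par v \<in> nb v" "par w \<in> nb w" using E_par[of v] E_par[of w] n vw by auto
      then have "par v = w" "par w = v" unfolding assms(1) w by simp_all
      then show False using depth_par[of v] depth_par[of w] n vw by auto
    qed
    ultimately have "V - {v, w} \<noteq> {}" by auto
    then obtain u where u: "u \<in> V - {v, w}" "\<And>x. x \<in> V - {v, w} \<Longrightarrow> depth u \<le> depth x"
      using ex_has_least_nat[of "\<lambda>u. u \<in> V - {v, w}" _ depth] by blast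
    have ur: "u \<noteq> root" using u \<open>root \<in> {v, w}\<close> by auto
    have "par u \<in> {v, w}"
    proof (rule ccontr)
      assume "par u \<notin> {v, w}"
      then have "depth u \<le> depth (par u)" using u E_par[of u] in_V2 ur by blast
      then show False using depth_par[of u] u ur by simp
    qed
    moreover have "u \<in> nb (par u)" using E_par[of u] u ur sym by simp
    ultimately have "u \<in> {v, w}" using w assms(1) by auto
    then show False using u by simp
  qed
  then have "card V \<le> card {v, w}" by (intro card_mono) auto
  also have "\<dots> \<le> 2" by (simp add: card_insert_if)
  finally show False using assms(2) by simp
qed

end

section \<open>Removing conflicts by exchanges\<close>

text \<open>Place the leaves \<open>I\<close> injectively on the free vertices with as few conflicts
  as possible. If a conflict remains, the failure of all exchanges shows that most leaves belong to
  at most \<open>k div 2\<close> vertices, and that \<open>x\<close> is not among these. Since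
  \<open>x\<close> has the most leaves of all but is left with few, \<open>card I\<close> is too
  small for \<open>big\<close>.\<close>

lemma extend_to_leaves:
  fixes E :: "'a \<Rightarrow> 'a \<Rightarrow> bool" and r :: "'b \<Rightarrow> 'b \<Rightarrow> bool"
  assumes "ugraph V E" "path_free_graph VR r k"
    and "card VR = card V + (k div 2 - 1)"
    and I: "I \<subseteq> V" "\<And>i. i \<in> I \<Longrightarrow> ugraph.nb E i = {s i}" "\<And>i. i \<in> I \<Longrightarrow> s i \<notin> I"
    and f: "inj_on f (V - I)" "f ` (V - I) \<subseteq> VR"
      "\<And>u v. u \<in> V - I \<Longrightarrow> v \<in> V - I \<Longrightarrow> E u v \<Longrightarrow> \<not> r (f u) (f v)"
    and x: "x \<in> V - I" "card (ugraph.nb r (f x) - f ` (V - I)) < k div 2"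
      "\<And>t. card {i \<in> I. s i = t} \<le> card {i \<in> I. s i = x}"
    and d: "\<And>i. i \<in> I \<Longrightarrow> ugraph.deg r (f (s i)) \<le> d"
    and big: "(k div 2 + 1) * (d + 1 - k div 2) < card I"
  shows "\<exists>g. inj_on g V \<and> g ` V \<subseteq> VR \<and> (\<forall>u v. E u v \<longrightarrow> \<not> r (g u) (g v))"
proof -
  interpret G: ugraph V E by fact
  interpret R: path_free_graph VR r k by fact
  define h where "h = k div 2"
  have h1: "1 \<le> h" using R.two_le_k by (simp add: h_def)
  define W where "W = VR - f ` (V - I)"
  have fI: "finite I" using I(1) G.finite_V finite_subset by blast
  have fW: "finite W" using R.finite_V by (simp add: W_def)
  have "card W = card VR - card (V - I)"
    using f G.finite_V by (simp add: W_def card_Diff_subset card_image)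
  moreover have "card (V - I) = card V - card I" "card I \<le> card V"
    using I(1) fI G.finite_V by (auto simp: card_Diff_subset card_mono)
  ultimately have cW: "card W = card I + (h - 1)" using assms(3) h_def by simp
  have sV: "s i \<in> V - I" if "i \<in> I" for i
    using that I(2,3)[OF that] G.nb_subset[of i] by auto
  have Ei: "E i w \<longleftrightarrow> w = s i" if "i \<in> I" for i w
    using I(2)[OF that] G.in_nb[of w i] by auto
  define cf where "cf g = {i \<in> I. r (f (s i)) (g i)}" for g
  define ok where "ok g \<longleftrightarrow> inj_on g I \<and> g ` I \<subseteq> W" for g
  have fcf: "finite (cf g)" for g using fI by (simp add: cf_def)
  have "\<exists>g. ok g"
    using card_le_inj[OF fI fW] cW unfolding ok_def by auto
  then obtain g where g: "ok g" "\<And>g'. ok g' \<Longrightarrow> card (cf g) \<le> card (cf g')"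
    using ex_has_least_nat[of ok _ "\<lambda>g. card (cf g)"] by blast
  have gi: "inj_on g I" "g ` I \<subseteq> W" using g(1) by (auto simp: ok_def)
  have "cf g = {}"
  proof (rule ccontr)
    assume "cf g \<noteq> {}"
    then obtain u where u: "u \<in> I" "r (f (s u)) (g u)" by (auto simp: cf_def)
    define w where "w = g u"
    define y where "y = f (s u)"
    have ywr: "r y w" using u by (simp add: y_def w_def)
    have improve: False if "ok g'" "cf g' \<subseteq> cf g - {u}" for g'
    proof -
      have "card (cf g') \<le> card (cf g - {u})" using that fcf by (intro card_mono) auto
      also have "\<dots> < card (cf g)" using u fcf by (intro card_Diff1_less) (auto simp: cf_def)
      finally show False using g(2)[OF that(1)] by simp
    qed
    define W0 where "W0 = W - g ` I"
    have cW0: "card W0 = h - 1"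
      using cW gi fW fI by (simp add: W0_def card_Diff_subset card_image)
    have fW0: "finite W0" using fW by (simp add: W0_def)
    \<comment> \<open>Otherwise moving \<open>u\<close> to the spare vertex \<open>w0\<close> would
      remove its conflict.\<close>
    have r0: "r y w0" if w0: "w0 \<in> W0" for w0
    proof (rule ccontr)
      assume n: "\<not> r y w0"
      have "ok (g(u := w0))" using gi w0 unfolding ok_def W0_def
        by (auto simp: inj_on_def)
      moreover have "cf (g(u := w0)) \<subseteq> cf g - {u}" using n by (auto simp: cf_def y_def)
      ultimately show False by (rule improve)
    qed
    define A where "A = insert w W0"
    have wW: "w \<in> W" "w \<notin> W0" using u gi by (auto simp: w_def W0_def)
    have AW: "A \<subseteq> W" using wW by (auto simp: A_def W0_def)
    have cA: "card A = h" using cW0 fW0 wW h1 by (simp add: A_def)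
    have yA: "r y a" if "a \<in> A" for a using that ywr r0 by (auto simp: A_def)
    define Q where "Q = {q \<in> I. \<not> r y (g q)}"
    have uQ: "u \<notin> Q" using ywr by (simp add: Q_def w_def)
    \<comment> \<open>Otherwise \<open>u\<close> could take the place of \<open>q\<close>, and
      \<open>q\<close> could move to \<open>a\<close>, which is spare or has just been left by
      \<open>u\<close>.\<close>
    have QA: "r (f (s q)) a" if q: "q \<in> Q" and a: "a \<in> A" for q a
    proof (rule ccontr)
      assume n: "\<not> r (f (s q)) a"
      define g' where "g' = g(u := g q, q := a)"
      have qu: "q \<noteq> u" "q \<in> I" "\<not> r y (g q)" using q uQ by (auto simp: Q_def)
      have "a \<notin> g ` (I - {u})" using a gi(1) u(1) by (auto simp: A_def w_def W0_def inj_on_def)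
      then have "ok g'" using gi a AW qu u(1) unfolding ok_def g'_def
        by (auto simp: inj_on_def)
      moreover have "cf g' \<subseteq> cf g - {u}" using n qu by (auto simp: cf_def y_def g'_def)
      ultimately show False by (rule improve)
    qed
    have "card (f ` s ` Q) \<le> h" unfolding h_def
    proof (rule R.card_common_nb)
      show "card A = k div 2" using cA by (simp add: h_def)
      show "A \<subseteq> VR" using AW by (auto simp: W_def)
      show "r a b" if "a \<in> A" "b \<in> f ` s ` Q" for a b
        using QA that R.sym by auto
    qed
    moreover have "card (f ` s ` Q) = card (s ` Q)"
      using sV f(1) by (intro card_image) (auto simp: Q_def inj_on_def)
    ultimately have csQ: "card (s ` Q) \<le> h" by simp
    \<comment> \<open>No vertex of \<open>A\<close> is occupied by \<open>f\<close>, so adjacency to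
      all of \<open>A\<close> would give \<open>f x\<close> at least \<open>k div 2\<close> free
      neighbours.\<close>
    have xQ: "x \<notin> s ` Q"
    proof
      assume "x \<in> s ` Q"
      then have "A \<subseteq> R.nb (f x) - f ` (V - I)" using QA AW by (auto simp: W_def)
      then have "h \<le> card (R.nb (f x) - f ` (V - I))" using cA card_mono[of "R.nb (f x) - f ` (V - I)" A] by simp
      then show False using x(2) by (simp add: h_def)
    qed
    have du: "R.deg y \<le> d" using d[OF u(1)] by (simp add: y_def)
    have "g ` (I - Q) \<union> W0 \<subseteq> R.nb y" using r0 by (auto simp: Q_def)
    then have "card (g ` (I - Q) \<union> W0) \<le> R.deg y" unfolding R.deg_def by (intro card_mono) auto
    moreover have "card (g ` (I - Q) \<union> W0) = card (g ` (I - Q)) + card W0"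
      using fI fW0 by (intro card_Un_disjoint) (auto simp: W0_def)
    moreover have "card (g ` (I - Q)) = card (I - Q)"
      using gi(1) by (intro card_image) (auto simp: inj_on_def)
    ultimately have IQ: "card (I - Q) \<le> d + 1 - h" using du cW0 h1 by linarith
    \<comment> \<open>Leaves outside \<open>Q\<close> sit on neighbours of \<open>y\<close>, and so
      do the \<open>h - 1\<close> spare vertices, hence there are at most \<open>d + 1 - h\<close>
      such leaves. This bounds the leaves at \<open>x\<close> and, by maximality, at each of the at
      most \<open>h\<close> parents of leaves in \<open>Q\<close>.\<close>
    have "{i \<in> I. s i = x} \<subseteq> I - Q" using xQ by auto
    then have lx: "card {i \<in> I. s i = x} \<le> d + 1 - h"
      using IQ fI card_mono[of "I - Q" "{i \<in> I. s i = x}"] by simp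
    have fQ: "finite Q" using fI by (simp add: Q_def)
    have "Q \<subseteq> (\<Union>t\<in>s ` Q. {i \<in> I. s i = t})" by (auto simp: Q_def)
    then have "card Q \<le> card (\<Union>t\<in>s ` Q. {i \<in> I. s i = t})"
      using fI fQ by (intro card_mono) auto
    also have "\<dots> \<le> (\<Sum>t\<in>s ` Q. card {i \<in> I. s i = t})" using fQ by (intro card_UN_le) auto
    also have "\<dots> \<le> card (s ` Q) * (d + 1 - h)"
      using sum_bounded_above[of "s ` Q" "\<lambda>t. card {i \<in> I. s i = t}", OF le_trans[OF x(3) lx]] by simp
    also have "\<dots> \<le> h * (d + 1 - h)" using csQ by simp
    finally have "card Q \<le> h * (d + 1 - h)" .
    moreover have "card I = card Q + card (I - Q)"
      using fI fQ card_mono[of I Q] by (simp add: card_Diff_subset Q_def)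
    ultimately show False using IQ big by (simp add: h_def)
  qed
  define F where "F v = (if v \<in> I then g v else f v)" for v
  have "inj_on F V"
    using gi f(1) unfolding F_def W_def inj_on_def by (smt (verit, best) DiffD2 DiffI imageI subsetD)
  moreover have "F ` V \<subseteq> VR" using gi f(2) by (auto simp: F_def W_def)
  moreover have "\<not> r (F u) (F v)" if uv: "E u v" for u v
  proof -
    have nr: "\<not> r (f (s i)) (g i)" if "i \<in> I" for i using \<open>cf g = {}\<close> that by (auto simp: cf_def)
    consider "u \<in> I" | "v \<in> I" | "u \<in> V - I" "v \<in> V - I" using uv G.in_V G.in_V2 by blast
    then show ?thesis
    proof cases
      case 1
      then have "v = s u" using Ei uv by simp
      then show ?thesis using 1 nr[OF 1] I(3)[OF 1] R.sym by (auto simp: F_def)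
    next
      case 2
      then have "u = s v" using Ei G.sym[OF uv] by simp
      then show ?thesis using 2 nr[OF 2] I(3)[OF 2] by (auto simp: F_def)
    next
      case 3
      then show ?thesis using f(3)[OF 3 uv] by (auto simp: F_def)
    qed
  qed
  ultimately show ?thesis by blast
qed

text \<open>Every conflict involves some \<open>u\<close> in \<open>S\<close>, whose degree is at
  most 3 and whose neighbours have images of degree at most \<open>d\<close>. It disappears when the
  images of \<open>u\<close> and a suitable \<open>w\<close> are swapped; the count says that the
  unsuitable vertices do not exhaust \<open>V\<close>. Both lie outside \<open>J\<close>, so the
  degree bound on images survives, and no conflict is created.\<close>

lemma resolve_conflicts:
  fixes E :: "'a \<Rightarrow> 'a \<Rightarrow> bool" and r :: "'b \<Rightarrow> 'b \<Rightarrow> bool"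
  assumes "ugraph V E" "ugraph VR r" "bij_betw f V V'" "J \<subseteq> V"
    and "\<And>v. v \<in> V - J \<Longrightarrow> ugraph.deg r (f v) \<le> d"
    and "\<And>u v. E u v \<Longrightarrow> r (f u) (f v) \<Longrightarrow> u \<in> S \<or> v \<in> S"
    and S: "\<And>u. u \<in> S \<Longrightarrow> u \<notin> J \<and> ugraph.deg E u \<le> 3 \<and> ugraph.nb E u \<inter> J = {}"
    and count: "card J + 4 + 5 * d + (\<Sum>v\<in>V. ugraph.deg E v - 2) < card V"
  shows "\<exists>g. bij_betw g V V' \<and> (\<forall>u v. E u v \<longrightarrow> \<not> r (g u) (g v))"
proof -
  interpret G: ugraph V E by fact
  interpret R: ugraph VR r by fact
  define cf where "cf f = {(u, v). E u v \<and> r (f u) (f v)}" for f :: "'a \<Rightarrow> 'b"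
  have "cf f \<subseteq> V \<times> V" for f
    using G.in_V G.in_V2 unfolding cf_def by blast
  then have fcf: "finite (cf f)" for f
    using G.finite_V finite_subset by (metis finite_SigmaI)
  show ?thesis using assms(3,5,6)
  proof (induction "card (cf f)" arbitrary: f rule: less_induct)
    case less
    note f = less.prems
    show ?case
    proof (cases "cf f = {}")
      case True
      then show ?thesis using f(1) by (auto simp: cf_def)
    next
      case False
      then obtain a b where ab: "E a b" "r (f a) (f b)" by (auto simp: cf_def)
      obtain u v where uv: "E u v" "r (f u) (f v)" "u \<in> S"
        using f(3)[OF ab] ab that[of a b] that[of b a] G.sym[OF ab(1)] R.sym[OF ab(2)] by blast
      have u: "u \<in> V" "u \<notin> J" "G.deg u \<le> 3" "G.nb u \<inter> J = {}"
        using uv(3) S G.in_V[OF uv(1)] by auto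
      have inj: "inj_on f V" using f(1) by (simp add: bij_betw_def)
      define N where "N = insert u (G.nb u)"
      define X where "X = (\<Union>y\<in>f ` G.nb u. R.nb y)"
      define B where "B = {w \<in> V. f w \<in> X}"
      define M where "M = {v \<in> V. r (f u) (f v)}"
      define C where "C = (\<Union>v\<in>M. G.nb v)"
      have "card N \<le> 4" using u(3) by (simp add: N_def G.deg_def card_insert_if)
      moreover have "card B \<le> 3 * d"
      proof -
        have "card (f ` G.nb u) \<le> 3" using card_image_le[of "G.nb u" f] u(3) by (simp add: G.deg_def)
        moreover have "card X \<le> card (f ` G.nb u) * d" unfolding X_def
          using f(2) u(4) G.nb_subset by (intro R.card_UN_nb_le) auto
        ultimately have "card X \<le> 3 * d" by (meson mult_le_mono1 order_trans)
        moreover have "card (f ` B) \<le> card X" unfolding B_def X_def by (intro card_mono) auto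
        moreover have "card (f ` B) = card B"
          using inj by (intro card_image) (auto simp: B_def inj_on_def)
        ultimately show ?thesis by simp
      qed
      \<comment> \<open>Single degrees in \<open>V\<close> may be large, but the total excess over 2
        is controlled: the degrees of at most \<open>d\<close> vertices sum to at most
        \<open>2 * d\<close> plus that excess.\<close>
      moreover have "card C \<le> 2 * d + (\<Sum>v\<in>V. G.deg v - 2)"
      proof -
        have fM: "finite M" using G.finite_V by (simp add: M_def)
        have "card (f ` M) \<le> R.deg (f u)" unfolding R.deg_def M_def by (intro card_mono) auto
        moreover have "card (f ` M) = card M"
          using inj by (intro card_image) (auto simp: M_def inj_on_def)
        ultimately have cM: "card M \<le> d" using f(2)[of u] u by simp
        have "card C \<le> (\<Sum>v\<in>M. G.deg v)" unfolding C_def G.deg_def using fM by (intro card_UN_le)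
        also have "\<dots> \<le> (\<Sum>v\<in>M. 2 + (G.deg v - 2))" by (intro sum_mono) simp
        also have "\<dots> = 2 * card M + (\<Sum>v\<in>M. G.deg v - 2)" by (subst sum.distrib) simp
        also have "(\<Sum>v\<in>M. G.deg v - 2) \<le> (\<Sum>v\<in>V. G.deg v - 2)"
          using G.finite_V by (intro sum_mono2) (auto simp: M_def)
        finally show ?thesis using cM by simp
      qed
      moreover have "card (J \<union> N \<union> B \<union> C) \<le> card J + card N + card B + card C"
        by (meson add_le_mono card_Un_le le_trans order_refl)
      ultimately have "card (J \<union> N \<union> B \<union> C) < card V" using count by linarith
      moreover have "finite (J \<union> N \<union> B \<union> C)"
        using assms(4) G.finite_V finite_subset by (auto simp: N_def B_def C_def M_def)
      ultimately have "\<not> V \<subseteq> J \<union> N \<union> B \<union> C" by (meson card_mono leD)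
      \<comment> \<open>Avoiding \<open>B\<close> keeps the new image of \<open>u\<close> harmless
        for the neighbours of \<open>u\<close>; avoiding \<open>C\<close> does the same for
        \<open>w\<close> and its neighbours. Avoiding \<open>N\<close> ensures that \<open>u\<close>
        and \<open>w\<close> are distinct and not adjacent.\<close>
      then obtain w where w: "w \<in> V" "w \<notin> J" "w \<notin> N" "w \<notin> B" "w \<notin> C" by blast
      define g where "g = f(u := f w, w := f u)"
      have wu: "w \<noteq> u" "\<not> E u w" "\<not> E w u" using w(3) G.sym by (auto simp: N_def)
      have W1: "\<not> r (f w) (f b)" "\<not> r (f b) (f w)" if "E u b" for b
        using w(1,4) that R.sym[of "f w" "f b"] by (auto simp: B_def X_def)
      have W2: "\<not> r (f u) (f b)" "\<not> r (f b) (f u)" if "E w b" for b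
        using w(5) R.sym[of "f b" "f u"] G.sym[OF that] G.in_V2[OF that] by (auto simp: C_def M_def)
      have sub: "cf g \<subseteq> cf f - {(u, v)}"
      proof (rule subrelI)
        fix a b assume "(a, b) \<in> cf g"
        then have ab: "E a b" "r (g a) (g b)" by (auto simp: cf_def)
        have "a \<noteq> b" using ab(1) G.irrefl by auto
        have "a \<noteq> u" "b \<noteq> u" "a \<noteq> w" "b \<noteq> w"
          using ab wu W1 W2 \<open>a \<noteq> b\<close> G.sym[OF ab(1)] unfolding g_def
          by (auto split: if_splits)
        then show "(a, b) \<in> cf f - {(u, v)}" using ab by (auto simp: cf_def g_def)
      qed
      have "card (cf g) \<le> card (cf f - {(u, v)})" using fcf sub by (intro card_mono) auto
      also have "\<dots> < card (cf f)" using fcf uv by (intro card_Diff1_less) (auto simp: cf_def)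
      finally have less: "card (cf g) < card (cf f)" .
      show ?thesis
      proof (rule less.hyps[OF less])
        have "inj_on g V" using inj u(1) w(1) wu(1) by (auto simp: g_def inj_on_def)
        moreover have "g ` V = f ` V" using u(1) w(1) wu(1) by (auto simp: g_def image_iff)
        ultimately show "bij_betw g V V'" using f(1) by (simp add: bij_betw_def)
        show "R.deg (g v) \<le> d" if "v \<in> V - J" for v
          using that f(2) u w by (auto simp: g_def)
        show "a \<in> S \<or> b \<in> S" if "E a b" "r (g a) (g b)" for a b
          using sub that f(3) by (auto simp: cf_def)
      qed
    qed
  qed
qed

lemma bij_betw_extend:
  assumes "finite V" "finite V'" "card V = card V'" "P \<subseteq> V" "inj_on f P" "f ` P \<subseteq> V'"
  shows "\<exists>g. bij_betw g V V' \<and> (\<forall>v\<in>P. g v = f v)"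
proof -
  have "card (V - P) = card (V' - f ` P)"
    using assms by (simp add: card_Diff_subset card_image finite_subset)
  then obtain h where h: "bij_betw h (V - P) (V' - f ` P)"
    using finite_same_card_bij[of "V - P" "V' - f ` P"] assms by auto
  define g where "g v = (if v \<in> P then f v else h v)" for v
  have "bij_betw g P (f ` P)" using assms(5) unfolding g_def bij_betw_def by (auto simp: inj_on_def)
  moreover have "bij_betw g (V - P) (V' - f ` P)"
    using h by (subst bij_betw_cong[of _ g h]) (auto simp: g_def)
  ultimately have "bij_betw g (P \<union> (V - P)) (f ` P \<union> (V' - f ` P))"
    by (rule bij_betw_combine) auto
  then show ?thesis using assms(4,6) by (intro exI[of _ g]) (auto simp: g_def Un_absorb1)
qed

context rooted_graph
begin

text \<open>Low-degree vertices with distinct parents and the same distance from the root modulo 3 have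
  disjoint closed neighbourhoods, as long as only tree edges are involved.\<close>

lemma ex_separated_set:
  assumes "3 * q + 9 * card core + 2 * (\<Sum>v\<in>V. deg v - 2) + 2 \<le> card V"
  shows "\<exists>J\<subseteq>V. card J = q \<and> J \<inter> core = {} \<and>
    (\<forall>j\<in>J. deg j \<le> 2 \<and> nb j \<inter> core = {} \<and> nb j \<inter> J = {}) \<and>
    (\<forall>j\<in>J. \<forall>j'\<in>J. j \<noteq> j' \<longrightarrow> nb j \<inter> nb j' = {})"
proof -
  define D where "D = (\<Sum>v\<in>V. deg v - 2)"
  define L where "L = {v \<in> V. v \<noteq> root \<and> deg v \<le> 2}"
  have fL: "finite L" using finite_V by (simp add: L_def)
  have cL: "card V \<le> card L + 1 + D"
  proof -
    have "card {v \<in> V. 2 < deg v} = (\<Sum>v\<in>{v \<in> V. 2 < deg v}. 1)" by simp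
    also have "\<dots> \<le> (\<Sum>v\<in>{v \<in> V. 2 < deg v}. deg v - 2)" by (intro sum_mono) auto
    also have "\<dots> \<le> D" unfolding D_def using finite_V by (intro sum_mono2) auto
    finally have "card {v \<in> V. 2 < deg v} \<le> D" .
    moreover have "V \<subseteq> insert root (L \<union> {v \<in> V. 2 < deg v})" by (auto simp: L_def)
    then have "card V \<le> card (insert root (L \<union> {v \<in> V. 2 < deg v}))"
      using fL finite_V by (intro card_mono) auto
    moreover have "\<dots> \<le> card {root} + card (L \<union> {v \<in> V. 2 < deg v})"
      by (metis card_Un_le insert_is_Un)
    moreover have "card (L \<union> {v \<in> V. 2 < deg v}) \<le> card L + card {v \<in> V. 2 < deg v}"
      by (rule card_Un_le)
    ultimately show ?thesis by simp
  qed
  \<comment> \<open>A vertex has at most \<open>1 + (deg t - 2)\<close> children in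
    \<open>L\<close>, the root one more, as it has no parent. So low-degree vertices have many
    different parents.\<close>
  have cp: "card L \<le> card (par ` L) + D + 1"
  proof -
    have sub: "par ` L \<subseteq> V" using E_par in_V2 by (auto simp: L_def)
    have "card L \<le> (\<Sum>t\<in>par ` L. card {v \<in> L. par v = t})"
    proof -
      have "L = (\<Union>t\<in>par ` L. {v \<in> L. par v = t})" by auto
      then have "card L = card (\<Union>t\<in>par ` L. {v \<in> L. par v = t})" by simp
      also have "\<dots> \<le> (\<Sum>t\<in>par ` L. card {v \<in> L. par v = t})"
        using fL by (intro card_UN_le) auto
      finally show ?thesis .
    qed
    also have "\<dots> \<le> (\<Sum>t\<in>par ` L. 1 + (deg t - 2) + (if t = root then 1 else 0))"
    proof (rule sum_mono)
      fix t assume t: "t \<in> par ` L"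
      have tV: "t \<in> V" using t sub by blast
      have sub1: "{v \<in> L. par v = t} \<subseteq> nb t" using E_par sym by (auto simp: L_def)
      show "card {v \<in> L. par v = t} \<le> 1 + (deg t - 2) + (if t = root then 1 else 0)"
      proof (cases "t = root")
        case True
        have "card {v \<in> L. par v = t} \<le> deg t" unfolding deg_def using sub1 by (intro card_mono) auto
        then show ?thesis using True by simp
      next
        case False
        have p: "par t \<in> nb t" using E_par[OF tV False] by simp
        have "par t \<notin> {v \<in> L. par v = t}"
        proof
          assume "par t \<in> {v \<in> L. par v = t}"
          then show False using depth_par[OF tV False] depth_par[of "par t"] by (auto simp: L_def)
        qed
        then have "card {v \<in> L. par v = t} \<le> card (nb t - {par t})" using sub1 by (intro card_mono) auto
        also have "\<dots> = deg t - 1" using p by (simp add: deg_def)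
        finally show ?thesis using False by simp
      qed
    qed
    also have "\<dots> = card (par ` L) + (\<Sum>t\<in>par ` L. deg t - 2) + (\<Sum>t\<in>par ` L. if t = root then 1 else 0)"
      by (simp only: sum.distrib) simp
    also have "(\<Sum>t\<in>par ` L. deg t - 2) \<le> D"
      unfolding D_def using finite_V sub by (intro sum_mono2) auto
    also have "(\<Sum>t\<in>par ` L. if t = root then 1 else 0) \<le> (1::nat)"
      using fL by (simp add: sum.delta)
    finally show ?thesis by simp
  qed
  define C where "C i = {v \<in> L. depth v mod 3 = i}" for i
  have "par ` L = par ` C 0 \<union> par ` C 1 \<union> par ` C 2"
  proof -
    have "depth v mod 3 = 0 \<or> depth v mod 3 = 1 \<or> depth v mod 3 = 2" for v by auto
    then have "L = C 0 \<union> C 1 \<union> C 2" by (auto simp: C_def)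
    then show ?thesis by (metis image_Un)
  qed
  then have "card (par ` L) = card (par ` C 0 \<union> par ` C 1 \<union> par ` C 2)" by simp
  then have "card (par ` L) \<le> card (par ` C 0) + card (par ` C 1) + card (par ` C 2)"
    using card_Un_le[of "par ` C 0 \<union> par ` C 1" "par ` C 2"] card_Un_le[of "par ` C 0" "par ` C 1"]
    by linarith
  then have "card (par ` L) \<le> 3 * card (par ` C 0) \<or> card (par ` L) \<le> 3 * card (par ` C 1) \<or>
      card (par ` L) \<le> 3 * card (par ` C 2)"
    by linarith
  then obtain i where i: "card (par ` L) \<le> 3 * card (par ` C i)" by blast
  \<comment> \<open>One vertex for each parent, within the residue class that has the most
    parents.\<close>
  obtain J0 where J0: "J0 \<subseteq> C i" "inj_on par J0" "par ` C i = par ` J0"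
    using subset_image_inj[of "par ` C i" par "C i"] by auto
  have fJ0: "finite J0" using J0(1) fL by (auto simp: C_def intro: finite_subset)
  \<comment> \<open>Core vertices, their children and their parents are removed, at most
    \<open>card core\<close> of each kind because parents are distinct on \<open>J0\<close>.\<close>
  define J1 where "J1 = J0 - core - {j \<in> J0. par j \<in> core} - par ` core"
  have fK: "finite core" using core_subset finite_V finite_subset by blast
  have "card J0 = card (par ` C i)" using J0(2,3) by (simp add: card_image)
  moreover have "card J0 \<le> card J1 + 3 * card core"
  proof -
    have "J0 \<subseteq> J1 \<union> core \<union> {j \<in> J0. par j \<in> core} \<union> par ` core" by (auto simp: J1_def)
    then have "card J0 \<le> card (J1 \<union> core \<union> {j \<in> J0. par j \<in> core} \<union> par ` core)"
      using fJ0 fK by (intro card_mono) (auto simp: J1_def)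
    also have "\<dots> \<le> card J1 + card core + card {j \<in> J0. par j \<in> core} + card (par ` core)"
      by (meson add_le_mono card_Un_le le_trans order_refl)
    also have "card {j \<in> J0. par j \<in> core} \<le> card core"
      using J0(2) fK by (intro card_inj_on_le[of par]) (auto simp: inj_on_def)
    also have "card (par ` core) \<le> card core" using fK by (rule card_image_le)
    finally show ?thesis by simp
  qed
  ultimately have "q \<le> card J1" using i cL cp assms unfolding D_def by linarith
  then obtain J where J: "J \<subseteq> J1" "card J = q" by (meson obtain_subset_with_card_n)
  have JV: "j \<in> V" "j \<noteq> root" "deg j \<le> 2" "j \<notin> core" "par j \<notin> core" "j \<notin> par ` core"
    "depth j mod 3 = i" if "j \<in> J" for j
    using that J(1) J0(1) by (auto simp: J1_def C_def L_def)
  have tr: "z = par j \<or> (z \<noteq> root \<and> z \<in> V \<and> par z = j)" if "j \<in> J" "E j z" for j z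
    using tree_edge[OF that(2) JV(4)[OF that(1)]] in_V2[OF that(2)] by auto
  have dm: "depth z mod 3 \<noteq> i" if "j \<in> J" "E j z" for j z
    using tree_edge[OF that(2) JV(4)[OF that(1)]] JV(1,2,7)[OF that(1)] in_V2[OF that(2)]
      depth_par[of j] depth_par[of z] by (auto simp: mod_Suc split: if_splits)
  \<comment> \<open>A common neighbour cannot be the parent of both, by the choice of
    \<open>J0\<close>, nor a child of both. If it is the parent of one and a child of the other, the
    depths differ by 2, which is impossible modulo 3.\<close>
  have disj: "nb j \<inter> nb j' = {}" if jj: "j \<in> J" "j' \<in> J" "j \<noteq> j'" for j j'
  proof (rule ccontr)
    assume "nb j \<inter> nb j' \<noteq> {}"
    then obtain z where z: "E j z" "E j' z" by auto
    have no: "par z \<noteq> j'" if *: "z = par j" "j \<in> J" "j' \<in> J" "z \<noteq> root" for j j'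
    proof
      assume "par z = j'"
      moreover have "z \<in> V" using z in_V2 by blast
      ultimately have "depth j = Suc (Suc (depth j'))"
        using depth_par[OF JV(1,2)[OF *(2)]] depth_par[of z] *(1,4) by simp
      then show False using JV(7)[OF *(2)] JV(7)[OF *(3)] by presburger
    qed
    show False
      using tr[OF jj(1) z(1)] tr[OF jj(2) z(2)] no[of j j'] no[of j' j] jj J0(2) J(1)
      by (auto simp: J1_def inj_on_def)
  qed
  show ?thesis
  proof (intro exI[of _ J] conjI ballI impI)
    show "J \<subseteq> V" "card J = q" "J \<inter> core = {}" using JV J(2) by auto
    show "deg j \<le> 2" if "j \<in> J" for j using JV(3)[OF that] .
    show "nb j \<inter> core = {}" if "j \<in> J" for j
      using tr[OF that] JV(5,6)[OF that] by force
    show "nb j \<inter> J = {}" if "j \<in> J" for j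
      using dm[OF that] JV(7) by force
    show "nb j \<inter> nb j' = {}" if "j \<in> J" "j' \<in> J" "j \<noteq> j'" for j j' using disj[OF that] .
  qed
qed

end

section \<open>Placing a sparse graph\<close>

text \<open>Three stages: \<open>P\<close> is prescribed by \<open>p\<close>, the rest of the core
  goes to an independent set of low-degree vertices, and \<open>U\<close> follows greedily, since
  edges at vertices outside the core are tree edges. In \<open>num\<close>, a vertex of
  \<open>U\<close> has to avoid the core images and their neighbours, the neighbours of prescribed
  images next to it (\<open>b\<close>), its parent's neighbours (\<open>d\<close>) and the values
  used for \<open>U\<close>.\<close>

lemma embed_core_greedily:
  fixes E :: "'a \<Rightarrow> 'a \<Rightarrow> bool" and r :: "'b \<Rightarrow> 'b \<Rightarrow> bool"
  assumes "rooted_graph V E rt par depth" "ugraph VR r"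
    and P: "P \<subseteq> V" "inj_on p P" "\<And>u v. u \<in> P \<Longrightarrow> v \<in> P \<Longrightarrow> E u v \<Longrightarrow> \<not> r (p u) (p v)"
    and K: "K = rooted_graph.core E rt par"
    and A: "A \<subseteq> VR" "A \<inter> p ` P = {}" "\<And>y. y \<in> A \<Longrightarrow> ugraph.deg r y \<le> \<delta>"
      "card K * (\<delta> + 1) \<le> card A"
      "\<And>u v y. u \<in> P \<Longrightarrow> v \<in> K \<Longrightarrow> E u v \<Longrightarrow> y \<in> A \<Longrightarrow> \<not> r (p u) y"
    and U: "U \<subseteq> V - P - K"
    and B: "B \<subseteq> VR" "B \<inter> p ` P = {}" "\<And>y. y \<in> B \<Longrightarrow> ugraph.deg r y \<le> d"
    and b: "\<And>v. v \<in> U \<Longrightarrow> card (\<Union>u\<in>ugraph.nb E v \<inter> P. ugraph.nb r (p u)) \<le> b"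
    and num: "card U + card (K - P) + card K * \<delta> + b + d \<le> card B"
  shows "\<exists>f. inj_on f (P \<union> K \<union> U) \<and> (\<forall>v\<in>P. f v = p v) \<and> f ` (K - P) \<subseteq> A \<and> f ` U \<subseteq> B \<and>
    (\<forall>u\<in>P \<union> K \<union> U. \<forall>v\<in>P \<union> K \<union> U. E u v \<longrightarrow> \<not> r (f u) (f v))"
proof -
  interpret G: rooted_graph V E rt par depth by fact
  interpret R: ugraph VR r by fact
  have fin: "finite P" "finite K" "finite U" "finite A" "finite B"
    using P(1) K G.core_subset U A(1) B(1) G.finite_V R.finite_V finite_subset by blast+
  \<comment> \<open>With independent images, edges between these core vertices cannot cause
    conflicts, however they are arranged.\<close>
  obtain A' where A': "A' \<subseteq> A" "card A' = card K" "\<forall>u\<in>A'. \<forall>v\<in>A'. \<not> r u v"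
    using R.ex_independent_subset[OF fin(4) A(3) A(4)] by blast
  have fA': "finite A'" using A'(1) fin(4) finite_subset by blast
  obtain f1 where f1: "bij_betw f1 K A'"
    using finite_same_card_bij[OF fin(2) fA'] A'(2) by auto
  have f1K: "f1 u \<in> A'" if "u \<in> K" for u using f1 that by (auto simp: bij_betw_def)
  \<comment> \<open>The neighbours of all core images are excluded, not only those relevant for
    \<open>v\<close>.\<close>
  define X where "X v = f1 ` (K - P) \<union> (\<Union>u\<in>G.nb v \<inter> P. R.nb (p u)) \<union> (\<Union>y\<in>f1 ` (K - P). R.nb y)" for v
  define T where "T v = B - X v" for v
  have cX: "card (X v) \<le> card (K - P) + b + card K * \<delta>" if "v \<in> U" for v
  proof -
    have c1: "card (f1 ` (K - P)) \<le> card (K - P)" using fin by (intro card_image_le) simp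
    moreover have "card (\<Union>y\<in>f1 ` (K - P). R.nb y) \<le> card (f1 ` (K - P)) * \<delta>"
      using fin f1K A'(1) A(3) by (intro R.card_UN_nb_le) auto
    moreover have "card (f1 ` (K - P)) * \<delta> \<le> card K * \<delta>"
      using c1 card_mono[of K "K - P"] fin by (intro mult_le_mono1) (meson Diff_subset le_trans)
    ultimately show ?thesis using b[OF that] unfolding X_def
      by (meson add_le_mono card_Un_le le_trans)
  qed
  have "\<exists>f2. inj_on f2 U \<and> (\<forall>v\<in>U. f2 v \<in> T v) \<and> (\<forall>u\<in>U. \<forall>v\<in>U. E u v \<longrightarrow> \<not> r (f2 u) (f2 v))"
  proof (rule greedy_embedding[where par = par and depth = depth and d = d, OF assms(2) fin(3) G.sym G.irrefl])
    show "(u = par v \<and> depth u < depth v) \<or> (v = par u \<and> depth v < depth u)"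
      if "u \<in> U" "v \<in> U" "E u v" for u v
      using G.tree_edge[OF that(3)] that(1) U K by blast
    show "finite (T v) \<and> card U + d \<le> card (T v)" if "v \<in> U" for v
    proof
      have "finite (X v)" using fin by (auto simp: X_def)
      then have "card B - card (X v) \<le> card (T v)" unfolding T_def by (rule diff_card_le_card_Diff)
      then show "card U + d \<le> card (T v)" using cX[OF that] num by linarith
    qed (use fin in \<open>simp add: T_def\<close>)
    show "R.deg y \<le> d" if "y \<in> T v" for v y using that B(3) by (simp add: T_def)
  qed
  then obtain f2 where f2: "inj_on f2 U" "\<And>v. v \<in> U \<Longrightarrow> f2 v \<in> T v"
    "\<And>u v. u \<in> U \<Longrightarrow> v \<in> U \<Longrightarrow> E u v \<Longrightarrow> \<not> r (f2 u) (f2 v)" by blast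
  define f where "f v = (if v \<in> P then p v else if v \<in> K then f1 v else f2 v)" for v
  have fP: "f v = p v" if "v \<in> P" for v using that by (simp add: f_def)
  have fK: "f v = f1 v" if "v \<in> K - P" for v using that by (simp add: f_def)
  have fU: "f v = f2 v" if "v \<in> U" for v using that U by (auto simp: f_def)
  have f2X: "f2 v \<in> B" "f2 v \<notin> X v" if "v \<in> U" for v using f2(2)[OF that] by (auto simp: T_def)
  have imP: "f ` P = p ` P" using fP by simp
  have imK: "f ` (K - P) \<subseteq> A" using fK f1K A'(1) by auto
  have imU: "f ` U \<subseteq> B" using fU f2X(1) by auto
  have KU0: "f ` (K - P) \<inter> f ` U = {}"
  proof -
    have "f2 v \<noteq> f1 u" if "v \<in> U" "u \<in> K - P" for u v
      using f2X(2)[OF that(1)] that(2) by (auto simp: X_def)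
    then show ?thesis using fK fU by (fastforce simp: image_iff)
  qed
  have inj_Un: "inj_on f (X \<union> Y)" if "inj_on f X" "inj_on f Y" "f ` X \<inter> f ` Y = {}" for X Y
    using that unfolding inj_on_Un by blast
  have "inj_on f P" using P(2) fP by (simp add: inj_on_def)
  moreover have "inj_on f (K - P)" using f1 fK by (simp add: inj_on_def bij_betw_def)
  moreover have "f ` P \<inter> f ` (K - P) = {}" using A(2) imP imK by blast
  ultimately have "inj_on f (P \<union> (K - P))" by (rule inj_Un)
  moreover have "inj_on f U" using f2(1) fU by (simp add: inj_on_def)
  moreover have "f ` (P \<union> (K - P)) \<inter> f ` U = {}"
  proof -
    have "p ` P \<inter> f ` U \<subseteq> B \<inter> p ` P" using imU by fast
    then show ?thesis using B(2) KU0 unfolding image_Un imP Int_Un_distrib2 by simp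
  qed
  ultimately have "inj_on f (P \<union> (K - P) \<union> U)" by (rule inj_Un)
  then have inj: "inj_on f (P \<union> K \<union> U)" by (simp add: Un_Diff_cancel)
  have PK: "\<not> r (f u) (f v)" if "u \<in> P" "v \<in> K - P" "E u v" for u v
    using A(5)[OF that(1) _ that(3)] that(2) f1K[of v] A'(1) fP[OF that(1)] fK[OF that(2)] by auto
  have PU: "\<not> r (f u) (f v)" if "u \<in> P" "v \<in> U" "E u v" for u v
    using f2X(2)[OF that(2)] that(1) G.sym[OF that(3)] fP[OF that(1)] fU[OF that(2)] by (auto simp: X_def)
  have KU: "\<not> r (f u) (f v)" if "u \<in> K - P" "v \<in> U" for u v
    using f2X(2)[OF that(2)] that(1) fK[OF that(1)] fU[OF that(2)] by (auto simp: X_def)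
  have nr: "\<not> r (f u) (f v)" if un: "u \<in> P \<union> K \<union> U" "v \<in> P \<union> K \<union> U" and e: "E u v" for u v
  proof -
    note e' = G.sym[OF e]
    have swp: "\<not> r (f u) (f v)" if "\<not> r (f v) (f u)" using that R.sym by blast
    consider "u \<in> P" "v \<in> P" | "u \<in> P" "v \<in> K - P" | "u \<in> P" "v \<in> U"
      | "u \<in> K - P" "v \<in> P" | "u \<in> K - P" "v \<in> K - P" | "u \<in> K - P" "v \<in> U"
      | "u \<in> U" "v \<in> P" | "u \<in> U" "v \<in> K - P" | "u \<in> U" "v \<in> U"
      using un by blast
    then show ?thesis
    proof cases
      case 1 then show ?thesis using P(3) e fP by simp
    next case 2 then show ?thesis using PK e by simp
    next case 3 then show ?thesis using PU e by simp
    next case 4 then show ?thesis using PK e' swp by blast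
    next case 5 then show ?thesis using A'(3) f1K fK by auto
    next case 6 then show ?thesis using KU by simp
    next case 7 then show ?thesis using PU e' swp by blast
    next case 8 then show ?thesis using KU swp by blast
    next case 9 then show ?thesis using f2(3) e fU by simp
    qed
  qed
  show ?thesis using inj nr fP imK imU by (intro exI[of _ f]) blast
qed

text \<open>All vertices except the leaves outside \<open>F\<close> are placed first. The set
  \<open>F\<close> occupies neighbours of \<open>p x\<close>, so that fewer than
  \<open>k div 2\<close> of them stay free, as \<open>extend_to_leaves\<close> requires.\<close>

lemma embed_many_leaves:
  fixes E :: "'a \<Rightarrow> 'a \<Rightarrow> bool" and r :: "'b \<Rightarrow> 'b \<Rightarrow> bool"
  assumes "rooted_graph V E rt par depth" "path_free_graph VR r k"
    and "card VR = card V + (k div 2 - 1)" "3 \<le> card V"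
    and L: "L = {v \<in> V. ugraph.deg E v = 1}"
    and x: "x \<in> V - L" "\<And>t. card {v \<in> L. E v t} \<le> card {v \<in> L. E v x}"
    and F: "F \<subseteq> V - {x}" "\<And>v. v \<in> F \<Longrightarrow> \<not> E x v" "\<And>u v. u \<in> F \<Longrightarrow> v \<in> F \<Longrightarrow> \<not> E u v"
    and p: "inj_on p (insert x F)" "p ` insert x F \<subseteq> VR"
      "card (ugraph.nb r (p x) - p ` F) < k div 2"
      "\<And>u. u \<in> insert x F \<Longrightarrow> ugraph.deg r (p u) \<le> d"
      "card (\<Union>u\<in>insert x F. ugraph.nb r (p u)) \<le> b"
    and K: "K = rooted_graph.core E rt par"
    and "\<delta> \<le> d"
    and num1: "card K * (\<delta> + 1) + Suc (card F) + b \<le> card {y \<in> VR. ugraph.deg r y \<le> \<delta>}"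
    and num2: "card V + card F + card K * \<delta> + b + d \<le> card {y \<in> VR. ugraph.deg r y \<le> d} + card L"
    and num3: "(k div 2 + 1) * (d + 1 - k div 2) + card F < card L"
  shows "\<exists>g. inj_on g V \<and> g ` V \<subseteq> VR \<and> (\<forall>u v. E u v \<longrightarrow> \<not> r (g u) (g v))"
proof -
  interpret G: rooted_graph V E rt par depth by fact
  interpret R: path_free_graph VR r k by fact
  define P where "P = insert x F"
  define I where "I = L - F"
  define s where "s i = the_elem (G.nb i)" for i
  have fin: "finite F" "finite K" "finite L" "finite P" "finite I"
    using finite_subset[of F V] F(1) finite_subset[OF G.core_subset] K G.finite_V
    unfolding P_def I_def L by auto
  have nbL: "G.nb i = {s i}" if "i \<in> L" for i
  proof -
    have "card (G.nb i) = 1" using that by (simp add: L G.deg_def)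
    then obtain w where "G.nb i = {w}" by (rule card_1_singletonE)
    then show ?thesis by (simp add: s_def)
  qed
  have "i \<notin> K" if "i \<in> L" for i using G.leaf_notin_core[OF nbL[OF that]] K by simp
  then have LK: "L \<inter> K = {}" by blast
  have sL: "s i \<notin> L" if "i \<in> L" for i
    using G.leaf_nb_not_leaf[OF nbL[OF that] assms(4)] L by simp
  have PV: "P \<subseteq> V" using x F by (auto simp: P_def)
  have IV: "I \<subseteq> V" by (auto simp: I_def L)
  have "x \<notin> F" using F(1) by blast
  then have cP: "card P = Suc (card F)" using fin by (simp add: P_def)
  define lo where "lo = {y \<in> VR. R.deg y \<le> \<delta>}"
  define li where "li = {y \<in> VR. R.deg y \<le> d}"
  \<comment> \<open>Core images are kept away from the prescribed images and all their neighbours,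
    so edges between core and \<open>P\<close> are safe.\<close>
  define X where "X = p ` P \<union> (\<Union>u\<in>P. R.nb (p u))"
  define U where "U = V - I - P - K"
  define B where "B = li - p ` P"
  have cimg: "card (p ` P) = card P" unfolding P_def by (rule card_image) (rule p(1))
  have sublo: "lo \<subseteq> VR" "li \<subseteq> VR" by (auto simp: lo_def li_def)
  have "\<exists>f. inj_on f (P \<union> K \<union> U) \<and> (\<forall>v\<in>P. f v = p v) \<and> f ` (K - P) \<subseteq> lo - X \<and> f ` U \<subseteq> B \<and>
    (\<forall>u\<in>P \<union> K \<union> U. \<forall>v\<in>P \<union> K \<union> U. E u v \<longrightarrow> \<not> r (f u) (f v))"
  proof (rule embed_core_greedily[OF assms(1) R.ugraph_axioms PV _ _ K])
    show "inj_on p P" using p(1) by (simp add: P_def)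
    show "\<not> r (p u) (p v)" if "u \<in> P" "v \<in> P" "E u v" for u v
      using that F(2,3) G.irrefl G.sym[OF that(3)] by (auto simp: P_def)
    show "lo - X \<subseteq> VR" "(lo - X) \<inter> p ` P = {}" "B \<subseteq> VR" "B \<inter> p ` P = {}"
      using sublo by (auto simp: X_def B_def)
    show "R.deg y \<le> \<delta>" if "y \<in> lo - X" for y using that by (auto simp: lo_def)
    show "R.deg y \<le> d" if "y \<in> B" for y using that by (auto simp: B_def li_def)
    show "card K * (\<delta> + 1) \<le> card (lo - X)"
    proof -
      have "card X \<le> card P + b"
        using card_Un_le[of "p ` P" "\<Union>u\<in>P. R.nb (p u)"] p(5) cimg by (simp add: X_def P_def)
      moreover have "card lo - card X \<le> card (lo - X)"
        using fin by (intro diff_card_le_card_Diff) (auto simp: X_def)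
      ultimately show ?thesis using num1 cP unfolding lo_def by linarith
    qed
    show "\<not> r (p u) y" if "u \<in> P" "y \<in> lo - X" for u y
      using that by (auto simp: X_def)
    show "U \<subseteq> V - P - K" by (auto simp: U_def)
    show "card (\<Union>u\<in>G.nb v \<inter> P. R.nb (p u)) \<le> b" for v
      using p(5) fin card_mono[of "\<Union>u\<in>P. R.nb (p u)" "\<Union>u\<in>G.nb v \<inter> P. R.nb (p u)"]
      unfolding P_def[symmetric] by fastforce
    show "card U + card (K - P) + card K * \<delta> + b + d \<le> card B"
    proof -
      have "V = U \<union> (K - P) \<union> P \<union> I" "(U \<union> (K - P)) \<inter> P = {}" "U \<inter> (K - P) = {}"
        "(U \<union> (K - P) \<union> P) \<inter> I = {}"
        using PV IV K G.core_subset LK x F(1) by (auto simp: U_def I_def P_def)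
      moreover have "finite U" using G.finite_V by (simp add: U_def)
      ultimately have "card V = card U + card (K - P) + card P + card I"
        using fin by (metis card_Un_disjoint finite_Diff finite_UnI)
      moreover have "card L - card F \<le> card I" unfolding I_def using fin by (intro diff_card_le_card_Diff)
      moreover have "p ` P \<subseteq> li" using p(2,4) by (auto simp: li_def P_def)
      then have "card B = card li - card P" "card P \<le> card li"
        using fin finite_subset[OF sublo(2) R.finite_V] cimg card_mono[of li "p ` P"]
        unfolding B_def by (auto simp: card_Diff_subset)
      ultimately show ?thesis using num2 num3 unfolding li_def by linarith
    qed
  qed
  moreover have PKU: "P \<union> K \<union> U = V - I"
    using PV K G.core_subset LK x F(1) by (auto simp: U_def I_def P_def)
  ultimately obtain f where f: "inj_on f (V - I)" "\<And>v. v \<in> P \<Longrightarrow> f v = p v"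
    "f ` (K - P) \<subseteq> lo - X" "f ` U \<subseteq> B"
    "\<And>u v. u \<in> V - I \<Longrightarrow> v \<in> V - I \<Longrightarrow> E u v \<Longrightarrow> \<not> r (f u) (f v)" by auto
  have fli: "f v \<in> li" if "v \<in> V - I" for v
  proof -
    have "v \<in> P \<or> v \<in> K - P \<or> v \<in> U" using that PKU by blast
    then show ?thesis
      using f(2)[of v] f(3,4) p(2,4) \<open>\<delta> \<le> d\<close> by (auto simp: li_def B_def lo_def P_def)
  qed
  have eqx: "{i \<in> I. s i = t} = {v \<in> L. E v t} - F" for t
  proof -
    have "E v t \<longleftrightarrow> s v = t" if "v \<in> L" for v
      using G.in_nb[of t v] nbL[OF that] by auto
    then show ?thesis by (auto simp: I_def)
  qed
  show ?thesis
  proof (rule extend_to_leaves[OF G.ugraph_axioms assms(2,3) IV, where s = s and f = f and x = x and d = d])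
    show "G.nb i = {s i}" "s i \<notin> I" if "i \<in> I" for i
      using that nbL sL by (auto simp: I_def)
    show "inj_on f (V - I)" by (rule f(1))
    show "f ` (V - I) \<subseteq> VR" using fli by (auto simp: li_def)
    show "\<not> r (f u) (f v)" if "u \<in> V - I" "v \<in> V - I" "E u v" for u v using f(5)[OF that] .
    show "x \<in> V - I" using x by (auto simp: I_def)
    have "f ` F = p ` F" using f(2) by (auto simp: P_def image_iff)
    moreover have "F \<subseteq> V - I" using F by (auto simp: I_def)
    ultimately have "R.nb (f x) - f ` (V - I) \<subseteq> R.nb (p x) - p ` F"
      using f(2)[of x] by (auto simp: P_def)
    then have "card (R.nb (f x) - f ` (V - I)) \<le> card (R.nb (p x) - p ` F)" by (intro card_mono) auto
    then show "card (R.nb (f x) - f ` (V - I)) < k div 2" using p(3) by simp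
    \<comment> \<open>\<open>F\<close> contains no neighbour of \<open>x\<close>, so
      \<open>x\<close> keeps all its leaves while other vertices may lose some.\<close>
    show "card {i \<in> I. s i = t} \<le> card {i \<in> I. s i = x}" for t
    proof -
      have "card {i \<in> I. s i = t} \<le> card {v \<in> L. E v t}"
        unfolding eqx using fin by (intro card_mono) auto
      also have "\<dots> \<le> card {v \<in> L. E v x}" by (rule x(2))
      also have "{v \<in> L. E v x} = {i \<in> I. s i = x}" unfolding eqx using F(2) G.sym by blast
      finally show ?thesis .
    qed
    show "R.deg (f (s i)) \<le> d" if "i \<in> I" for i
    proof -
      have "s i \<in> V - I" using that nbL[of i] sL[of i] G.nb_subset[of i] by (auto simp: I_def)
      then show ?thesis using fli by (simp add: li_def)
    qed
    have "card L - card F \<le> card I" unfolding I_def using fin by (intro diff_card_le_card_Diff)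
    then show "(k div 2 + 1) * (d + 1 - k div 2) < card I" using num3 by linarith
  qed
qed

text \<open>After discarding the surplus vertices, \<open>G\<close> has to be placed bijectively.
  Every remaining vertex of degree above \<open>d\<close> receives a vertex of the separated set
  \<open>J\<close>; once \<open>J\<close>, its neighbours, the core and all vertices of degree at
  least 4 are placed without conflict, the hypotheses of \<open>resolve_conflicts\<close> hold for
  any extension.\<close>

lemma embed_few_leaves:
  fixes E :: "'a \<Rightarrow> 'a \<Rightarrow> bool" and r :: "'b \<Rightarrow> 'b \<Rightarrow> bool"
  assumes "rooted_graph V E rt par depth" "path_free_graph VR r k"
    and VR: "card VR = card V + (k div 2 - 1)"
    and K: "K = rooted_graph.core E rt par"
    and D: "D = (\<Sum>v\<in>V. ugraph.deg E v - 2)"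
    and "\<delta> \<le> d"
    and q: "card {y \<in> VR. d < ugraph.deg r y} \<le> q"
    and num1: "3 * q + 9 * card K + 2 * D + 2 \<le> card V"
    and num2: "card K * (\<delta> + 1) + k div 2 \<le> card {y \<in> VR. ugraph.deg r y \<le> \<delta>}"
    and num3: "6 * q + D + 2 * (card K * (\<delta> + 1)) + card VR + k + 2 * d \<le> 2 * card V"
    and num4: "q + 4 + 5 * d + D < card V"
  shows "\<exists>g. inj_on g V \<and> g ` V \<subseteq> VR \<and> (\<forall>u v. E u v \<longrightarrow> \<not> r (g u) (g v))"
proof -
  interpret G: rooted_graph V E rt par depth by fact
  interpret R: path_free_graph VR r k by fact
  define m where "m = k div 2 - 1"
  have h: "k div 2 = Suc m" using R.two_le_k by (simp add: m_def)
  \<comment> \<open>The vertices adjacent to more than about half of the graph. By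
    \<open>card_very_heavy\<close> they fit into the \<open>m\<close> discarded vertices; if one
    were used, too little room would be left for the neighbours of the vertex placed there.\<close>
  define Z where "Z = {v \<in> VR. card VR + k + 1 \<le> 2 * R.deg v}"
  have "card Z \<le> m" using R.card_very_heavy h by (simp add: Z_def)
  moreover have "m \<le> card VR" using VR by (simp add: m_def)
  moreover have "Z \<subseteq> VR" by (auto simp: Z_def)
  ultimately obtain M where M: "Z \<subseteq> M" "M \<subseteq> VR" "card M = m"
    using R.finite_V exists_subset_between[of Z m VR] by auto
  have fM: "finite M" using M R.finite_V finite_subset by blast
  define W where "W = VR - M"
  have fW: "finite W" using R.finite_V by (simp add: W_def)
  have cW: "card W = card V" using M VR fM by (simp add: W_def card_Diff_subset m_def)
  define H where "H = {y \<in> W. d < R.deg y}"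
  have fH: "finite H" using fW by (simp add: H_def)
  have "card H \<le> card {y \<in> VR. d < R.deg y}"
    using R.finite_V by (intro card_mono) (auto simp: H_def W_def)
  then have cH: "card H \<le> q" using q by simp
  have "\<exists>J\<subseteq>V. card J = card H \<and> J \<inter> K = {} \<and>
    (\<forall>j\<in>J. G.deg j \<le> 2 \<and> G.nb j \<inter> K = {} \<and> G.nb j \<inter> J = {}) \<and>
    (\<forall>j\<in>J. \<forall>j'\<in>J. j \<noteq> j' \<longrightarrow> G.nb j \<inter> G.nb j' = {})"
    unfolding K by (rule G.ex_separated_set) (use num1 cH K D in simp)
  then obtain J where J: "J \<subseteq> V" "card J = card H" "J \<inter> K = {}"
    "\<And>j. j \<in> J \<Longrightarrow> G.deg j \<le> 2" "\<And>j. j \<in> J \<Longrightarrow> G.nb j \<inter> K = {}" "\<And>j. j \<in> J \<Longrightarrow> G.nb j \<inter> J = {}"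
    "\<And>j j'. j \<in> J \<Longrightarrow> j' \<in> J \<Longrightarrow> j \<noteq> j' \<Longrightarrow> G.nb j \<inter> G.nb j' = {}" by auto
  have fJ: "finite J" using J(1) G.finite_V finite_subset by blast
  obtain p where p: "bij_betw p J H" using finite_same_card_bij[OF fJ fH J(2)] by blast
  define C where "C = {v \<in> V. 4 \<le> G.deg v}"
  define U where "U = (\<Union>j\<in>J. G.nb j) \<union> C - J - K"
  define A where "A = {y \<in> W. R.deg y \<le> \<delta>}"
  define B where "B = W - H"
  have fK: "finite K" using K G.core_subset G.finite_V finite_subset by blast
  have cC: "2 * card C \<le> D"
  proof -
    have "card C * 2 = (\<Sum>v\<in>C. 2)" by simp
    also have "\<dots> \<le> (\<Sum>v\<in>C. G.deg v - 2)" by (intro sum_mono) (auto simp: C_def)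
    also have "\<dots> \<le> D" unfolding D using G.finite_V by (intro sum_mono2) (auto simp: C_def)
    finally show ?thesis by simp
  qed
  have cU: "card U \<le> 2 * q + card C"
  proof -
    have "card U \<le> card ((\<Union>j\<in>J. G.nb j) \<union> C)"
      using fJ G.finite_V unfolding U_def by (intro card_mono) (auto simp: C_def)
    also have "\<dots> \<le> card (\<Union>j\<in>J. G.nb j) + card C" by (rule card_Un_le)
    also have "card (\<Union>j\<in>J. G.nb j) \<le> card J * 2" using fJ J(4) by (intro G.card_UN_nb_le)
    finally show ?thesis using J(2) cH by simp
  qed
  have "\<exists>f. inj_on f (J \<union> K \<union> U) \<and> (\<forall>v\<in>J. f v = p v) \<and> f ` (K - J) \<subseteq> A \<and> f ` U \<subseteq> B \<and>
    (\<forall>u\<in>J \<union> K \<union> U. \<forall>v\<in>J \<union> K \<union> U. E u v \<longrightarrow> \<not> r (f u) (f v))"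
  proof (rule embed_core_greedily[OF assms(1) R.ugraph_axioms J(1) _ _ K,
        where b = "(card VR + k) div 2" and \<delta> = \<delta> and d = d])
    show "inj_on p J" using p by (simp add: bij_betw_def)
    show "\<not> r (p u) (p v)" if "u \<in> J" "v \<in> J" "E u v" for u v
      using J(6)[of u] that by auto
    show "A \<subseteq> VR" "B \<subseteq> VR" by (auto simp: A_def B_def W_def)
    show "A \<inter> p ` J = {}" "B \<inter> p ` J = {}"
      using p \<open>\<delta> \<le> d\<close> by (auto simp: bij_betw_def A_def B_def H_def)
    show "R.deg y \<le> \<delta>" if "y \<in> A" for y using that by (simp add: A_def)
    show "R.deg y \<le> d" if "y \<in> B" for y using that by (auto simp: B_def H_def)
    show "card K * (\<delta> + 1) \<le> card A"
    proof -
      have "{y \<in> VR. R.deg y \<le> \<delta>} \<subseteq> A \<union> M" by (auto simp: A_def W_def)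
      then have "card {y \<in> VR. R.deg y \<le> \<delta>} \<le> card (A \<union> M)"
        using fM fW by (intro card_mono) (auto simp: A_def)
      also have "\<dots> \<le> card A + m" using card_Un_le[of A M] M(3) by simp
      finally show ?thesis using num2 h by simp
    qed
    show "\<not> r (p u) y" if "u \<in> J" "v \<in> K" "E u v" for u v y
      using that J(5)[of u] by auto
    show "U \<subseteq> V - J - K" using G.nb_subset by (auto simp: U_def C_def)
    \<comment> \<open>By separation \<open>v\<close> has at most one neighbour in \<open>J\<close>,
      and the image of that one is not in \<open>Z\<close>.\<close>
    show "card (\<Union>u\<in>G.nb v \<inter> J. R.nb (p u)) \<le> (card VR + k) div 2" for v
    proof (cases "G.nb v \<inter> J = {}")
      case False
      then obtain j where j: "j \<in> J" "E v j" by auto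
      have "G.nb v \<inter> J \<subseteq> {j}"
        using J(7)[OF j(1)] G.sym j(2) by (metis (no_types, lifting) G.in_nb IntD1 IntD2 IntI empty_iff singletonI subsetI)
      then have "(\<Union>u\<in>G.nb v \<inter> J. R.nb (p u)) \<subseteq> R.nb (p j)" by auto
      then have "card (\<Union>u\<in>G.nb v \<inter> J. R.nb (p u)) \<le> R.deg (p j)"
        unfolding R.deg_def by (intro card_mono) auto
      moreover have "p j \<in> W" using p j(1) by (auto simp: bij_betw_def H_def)
      then have "p j \<in> VR" "p j \<notin> Z" using M(1) by (auto simp: W_def)
      then have "2 * R.deg (p j) \<le> card VR + k" by (simp add: Z_def)
      ultimately show ?thesis by simp
    qed simp
    have "card B = card V - card H" using fH cW fW by (auto simp: B_def card_Diff_subset H_def)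
    moreover have "card (K - J) \<le> card K" using fK by (intro card_mono) auto
    ultimately show "card U + card (K - J) + card K * \<delta> + (card VR + k) div 2 + d \<le> card B"
      using num3 cU cC cH by (simp add: algebra_simps)
  qed
  then obtain f where f: "inj_on f (J \<union> K \<union> U)" "\<And>v. v \<in> J \<Longrightarrow> f v = p v" "f ` (K - J) \<subseteq> A" "f ` U \<subseteq> B"
    "\<And>u v. u \<in> J \<union> K \<union> U \<Longrightarrow> v \<in> J \<union> K \<union> U \<Longrightarrow> E u v \<Longrightarrow> \<not> r (f u) (f v)" by auto
  define P where "P = J \<union> K \<union> U"
  have fJ0: "f ` J = H" using f(2) p by (auto simp: bij_betw_def image_iff)
  have PV: "P \<subseteq> V" using J(1) K G.core_subset G.nb_subset by (auto simp: P_def U_def C_def)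
  have "f v \<in> W" if "v \<in> P" for v
  proof -
    have "v \<in> J \<or> v \<in> K - J \<or> v \<in> U" using that by (auto simp: P_def)
    then show ?thesis using fJ0 f(3,4) by (auto simp: H_def A_def B_def)
  qed
  then have "f ` P \<subseteq> W" by auto
  moreover have "inj_on f P" using f(1) by (simp add: P_def)
  ultimately obtain g where g: "bij_betw g V W" "\<And>v. v \<in> P \<Longrightarrow> g v = f v"
    using bij_betw_extend[OF G.finite_V fW _ PV, of f] cW by auto
  have gJ: "g ` J = H" using g(2) fJ0 by (auto simp: P_def image_iff)
  have "\<exists>g. bij_betw g V W \<and> (\<forall>u v. E u v \<longrightarrow> \<not> r (g u) (g v))"
  proof (rule resolve_conflicts[OF G.ugraph_axioms R.ugraph_axioms g(1) J(1), where S = "V - P" and d = d])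
    show "R.deg (g v) \<le> d" if "v \<in> V - J" for v
    proof -
      have "g v \<notin> g ` J" using that J(1) g(1) by (auto simp: bij_betw_def inj_on_def)
      moreover have "g v \<in> W" using that g(1) by (auto simp: bij_betw_def)
      ultimately show ?thesis using gJ by (auto simp: H_def)
    qed
    \<comment> \<open>There is no conflict inside \<open>P\<close>, so each one involves a vertex
      outside \<open>P\<close>; such a vertex has degree at most 3 and no neighbour in
      \<open>J\<close>.\<close>
    show "u \<in> V - P \<or> v \<in> V - P" if "E u v" "r (g u) (g v)" for u v
      using that f(5)[of u v] g(2)[of u] g(2)[of v] G.in_V G.in_V2 unfolding P_def by auto
    show "u \<notin> J \<and> G.deg u \<le> 3 \<and> G.nb u \<inter> J = {}" if "u \<in> V - P" for u
    proof (intro conjI)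
      show "u \<notin> J" using that by (simp add: P_def)
      have "u \<notin> U" "u \<notin> K" "u \<in> V" using that by (auto simp: P_def)
      then show "G.deg u \<le> 3" using \<open>u \<notin> J\<close> by (auto simp: U_def C_def)
      show "G.nb u \<inter> J = {}" using \<open>u \<notin> J\<close> \<open>u \<notin> U\<close> \<open>u \<notin> K\<close> G.sym by (auto simp: U_def)
    qed
    show "card J + 4 + 5 * d + (\<Sum>v\<in>V. G.deg v - 2) < card V" using num4 J(2) cH D by simp
  qed
  then show ?thesis unfolding bij_betw_def W_def by blast
qed

section \<open>Degree counts and the choice of thresholds\<close>

lemma (in rooted_graph) sum_deg_minus_two:
  assumes "2 \<le> card V"
  shows "(\<Sum>v\<in>V. deg v - 2) + 2 * card V = (\<Sum>v\<in>V. deg v) + card {v \<in> V. deg v = 1}"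
proof -
  \<comment> \<open>The truncated \<open>deg v - 2\<close> is too large by 1 exactly at the
    leaves.\<close>
  have "(\<Sum>v\<in>V. (deg v - 2) + 2) = (\<Sum>v\<in>V. deg v + (if deg v = 1 then 1 else 0))"
  proof (rule sum.cong[OF refl])
    fix v assume "v \<in> V"
    then have "0 < deg v" using deg_pos assms by blast
    then show "(deg v - 2) + 2 = deg v + (if deg v = 1 then 1 else 0)" by auto
  qed
  moreover have "(\<Sum>v\<in>V. if deg v = 1 then 1 else 0) = card {v \<in> V. deg v = 1}"
    using finite_V by (simp add: sum.If_cases Int_def)
  ultimately show ?thesis unfolding sum.distrib by simp
qed

lemma (in ugraph) card_low_degree:
  "card {y \<in> V. deg y \<le> d} + card {y \<in> V. d < deg y} = card V"
proof -
  have "{y \<in> V. deg y \<le> d} \<union> {y \<in> V. d < deg y} = V" by auto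
  moreover have "{y \<in> V. deg y \<le> d} \<inter> {y \<in> V. d < deg y} = {}" by auto
  ultimately show ?thesis
    using finite_V by (metis (no_types, lifting) card_Un_disjoint finite_Un)
qed

text \<open>By \<open>card_heavy\<close> the vertices of degree above \<open>2 * j\<close> make up
  at most the fraction \<open>j / (j + 1)\<close>.\<close>

lemma (in path_free_graph) card_low_degree_ge:
  assumes "k = j + 2" "1 \<le> j"
  shows "card V \<le> card {y \<in> V. deg y \<le> 2 * j} * (j + 1)"
proof -
  have "card {y \<in> V. 2 * j < deg y} * (2 * j + 1 - j) \<le> j * card V"
    using card_heavy[of "2 * j"] assms by simp
  moreover have "2 * j + 1 - j = j + 1" by simp
  moreover have "card V * (j + 1) = card {y \<in> V. deg y \<le> 2 * j} * (j + 1) + card {y \<in> V. 2 * j < deg y} * (j + 1)"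
    using card_low_degree[of "2 * j"] by (metis add_mult_distrib)
  ultimately show ?thesis by (simp add: algebra_simps)
qed

text \<open>Let \<open>y\<close> be the number of vertices that are not neighbours of
  \<open>x\<close>, including \<open>x\<close>. Edges at \<open>x\<close> contribute at least
  \<open>2 * deg x\<close> to the degree sum, so the degree sum inside the other
  \<open>y - 1\<close> vertices is at most \<open>2 * y + q\<close>. By \<open>turan\<close> they
  contain an independent set of about a third of them, and \<open>y\<close> exceeds
  \<open>sqrt n / 2\<close>, which is more than twice \<open>j + 2\<close>.\<close>

lemma (in rooted_graph) ex_independent_nonneighbours:
  assumes "x \<in> V" and n: "20 * (j + 2) ^ 2 \<le> card V" "27 * (j + 2) ^ 2 * q \<le> card V"
    and s: "(\<Sum>v\<in>V. deg v) \<le> 2 * card V + q"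
    and x: "deg x < card V" "card V < 4 * (card V - deg x) ^ 2"
    and t: "2 * t \<le> j + 1" and "1 \<le> j"
  shows "\<exists>F\<subseteq>V - {x}. card F = t \<and> (\<forall>v\<in>F. \<not> E x v) \<and> (\<forall>u\<in>F. \<forall>v\<in>F. \<not> E u v)"
proof -
  define Z where "Z = V - {x} - nb x"
  define z where "z = card Z"
  define y where "y = z + 1"
  have V: "V = Z \<union> insert x (nb x)" "Z \<inter> insert x (nb x) = {}" "finite Z"
    using assms(1) nb_subset finite_V by (auto simp: Z_def)
  have y: "card V - deg x = y"
  proof -
    have "card V = z + Suc (deg x)"
      using card_Un_disjoint[of Z "insert x (nb x)"] V not_self_nb
      by (simp add: z_def deg_def)
    then show ?thesis by (simp add: y_def)
  qed
  have "2 \<le> card V"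
  proof -
    have "1 ^ 2 \<le> (j + 2) ^ 2" by (rule power_mono) auto
    then show ?thesis using n(1) unfolding power_one by linarith
  qed
  define a where "a = (\<Sum>v\<in>Z. card (nb v \<inter> Z))"
  have "a + 2 * deg x \<le> (\<Sum>v\<in>V. deg v)"
  proof -
    have "a \<le> (\<Sum>v\<in>Z. deg v)" unfolding a_def deg_def by (intro sum_mono card_mono) auto
    moreover have "(\<Sum>v\<in>nb x. 1) \<le> (\<Sum>v\<in>nb x. deg v)"
      using deg_pos[OF in_V2 \<open>2 \<le> card V\<close>] by (intro sum_mono) (auto simp: Suc_le_eq)
    then have "deg x \<le> (\<Sum>v\<in>nb x. deg v)" by (simp add: deg_def)
    moreover have "(\<Sum>v\<in>V. deg v) = (\<Sum>v\<in>Z. deg v) + (\<Sum>v\<in>insert x (nb x). deg v)"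
      using V sum.union_disjoint[of Z "insert x (nb x)" deg] by simp
    moreover have "(\<Sum>v\<in>insert x (nb x). deg v) = deg x + (\<Sum>v\<in>nb x. deg v)"
      using not_self_nb by simp
    ultimately show ?thesis by linarith
  qed
  then have a: "a \<le> 2 * y + q" using s y x(1) by linarith
  have "Z \<subseteq> V" by (auto simp: Z_def)
  then obtain A where A: "A \<subseteq> Z" "\<forall>u\<in>A. \<forall>v\<in>A. \<not> E u v" "z ^ 2 \<le> card A * (a + z)"
    using turan[of Z] unfolding a_def z_def by blast
  have "t \<le> card A"
  proof (rule ccontr)
    assume "\<not> t \<le> card A"
    then have cA: "2 * card A \<le> j - 1" using t by linarith
    have y4: "card V < 4 * y ^ 2" using x(2) y by simp
    \<comment> \<open>Equivalent to \<open>(j - 4) ^ 2 \<ge> 0\<close>.\<close>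
    have "12 * (real j - 1) \<le> (real j + 2) ^ 2"
      using zero_le_power2[of "real j - 4"] by (simp add: power2_eq_square algebra_simps)
    then have "12 * (real j - 1) * q \<le> (real j + 2) ^ 2 * q" by (rule mult_right_mono) simp
    then have 1: "12 * ((real j - 1) * q) \<le> (real j + 2) ^ 2 * q" by (simp only: mult.assoc)
    have "real (27 * (j + 2) ^ 2 * q) \<le> real (4 * y ^ 2)"
      using n(2) y4 by (simp only: of_nat_le_iff)
    then have "27 * ((real j + 2) ^ 2 * q) \<le> 4 * (real y) ^ 2"
      by (simp add: mult.assoc add.commute)
    with 1 have jq: "81 * ((real j - 1) * q) \<le> (real y) ^ 2" by linarith
    have "5 * (real j + 2) ^ 2 \<le> (real y) ^ 2"
    proof -
      have "real (20 * (j + 2) ^ 2) \<le> real (4 * y ^ 2)" using n(1) y4 by (simp only: of_nat_le_iff)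
      then show ?thesis by (simp add: add.commute)
    qed
    \<comment> \<open>The fraction \<open>11 / 5\<close> stands in for \<open>sqrt 5\<close>, as
      \<open>121 / 25 < 5\<close>.\<close>
    then have "121 * (real j + 2) ^ 2 \<le> 25 * (real y) ^ 2"
      using zero_le_power2[of "real j + 2"] by linarith
    then have "(11 * (real j + 2)) ^ 2 \<le> (5 * real y) ^ 2"
      unfolding power_mult_distrib by simp
    then have jy: "11 * (real j + 2) \<le> 5 * real y" by (rule power2_le_imp_le) simp
    have "2 * real z ^ 2 \<le> 2 * (real (card A) * (a + z))"
      using A(3) by (metis (mono_tags, opaque_lifting) mult_left_mono of_nat_le_iff of_nat_mult of_nat_power zero_le_numeral)
    also have "\<dots> \<le> (real j - 1) * (a + z)"
    proof -
      have "real (2 * card A) \<le> real (j - 1)" using cA by (simp only: of_nat_le_iff)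
      then have "2 * real (card A) \<le> real j - 1" using \<open>1 \<le> j\<close> by (simp add: of_nat_diff)
      then have "2 * real (card A) * real (a + z) \<le> (real j - 1) * real (a + z)"
        by (rule mult_right_mono) simp
      then show ?thesis by simp
    qed
    also have "\<dots> \<le> (real j - 1) * (3 * real y - 1 + q)"
      using a \<open>1 \<le> j\<close> unfolding y_def by (intro mult_left_mono) auto
    also have "\<dots> = (real j - 1) * (3 * real y - 1) + (real j - 1) * q" by (simp add: algebra_simps)
    also have "(real j - 1) * (3 * real y - 1) \<le> (5 / 11 * real y - 3) * (3 * real y - 1)"
      using jy by (intro mult_right_mono) (auto simp: y_def)
    finally have "2 * (real y - 1) ^ 2 \<le> (5 / 11 * real y - 3) * (3 * real y - 1) + (real y) ^ 2 / 81"
      using jq by (simp add: y_def)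
    moreover have "(real y - 1) ^ 2 = (real y) ^ 2 - 2 * real y + 1"
      by (simp add: power2_eq_square algebra_simps)
    moreover have "(5 / 11 * real y - 3) * (3 * real y - 1) = 15 / 11 * (real y) ^ 2 - 104 / 11 * real y + 3"
      by (simp add: power2_eq_square field_simps)
    moreover have "1 \<le> real y" "0 \<le> (real y) ^ 2" by (simp_all add: y_def)
    ultimately show False by linarith
  qed
  then obtain F where "F \<subseteq> A" "card F = t" by (meson obtain_subset_with_card_n)
  then show ?thesis using A by (intro exI[of _ F]) (auto simp: Z_def)
qed

text \<open>Division-free form of: if \<open>h\<close> is at most \<open>n * N / (a * e)\<close> and
  \<open>e\<close> is at least \<open>b * n / a\<close>, then \<open>h\<close> is at most
  \<open>N / b\<close>. It turns \<open>card_heavy\<close> into a bound by a fixed fraction of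
  \<open>N\<close>.\<close>

lemma mult_le_mult_imp_le:
  fixes N :: nat
  assumes "a * (h * e) \<le> n * N" "b * n \<le> a * e" "0 < n"
  shows "b * h \<le> N"
proof -
  have "n * (b * h) = h * (b * n)" by simp
  also have "\<dots> \<le> h * (a * e)" using assms(2) by (rule mult_le_mono2)
  also have "\<dots> = a * (h * e)" by simp
  also have "\<dots> \<le> n * N" by (rule assms(1))
  finally show ?thesis using assms(3) by (simp only: mult_le_cancel1)
qed

text \<open>Here \<open>q\<close> bounds the surplus of the degree sum over
  \<open>2 * card V\<close>, and the last two hypotheses express the degree bound
  \<open>n - sqrt n / 2\<close> without a root. The three cases supply thresholds and prescribed
  vertices for the two placement lemmas.\<close>

theorem sparse_graph_embedding:
  fixes E :: "'a \<Rightarrow> 'a \<Rightarrow> bool" and r :: "'b \<Rightarrow> 'b \<Rightarrow> bool"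
  assumes "ugraph V E" "path_free_graph VR r k" "3 \<le> k"
    and VR: "card VR = card V + (k div 2 - 1)"
    and n20: "20 * k ^ 2 \<le> card V"
    and conn: "\<And>u v. u \<in> V \<Longrightarrow> v \<in> V \<Longrightarrow> (u, v) \<in> {(u, v). E u v}\<^sup>*"
    and s: "(\<Sum>v\<in>V. ugraph.deg E v) \<le> 2 * card V + q" "27 * k ^ 2 * q \<le> card V"
    and \<Delta>: "\<And>v. v \<in> V \<Longrightarrow> ugraph.deg E v < card V"
      "\<And>v. v \<in> V \<Longrightarrow> card V < 4 * (card V - ugraph.deg E v) ^ 2"
  shows "\<exists>g. inj_on g V \<and> g ` V \<subseteq> VR \<and> (\<forall>u v. E u v \<longrightarrow> \<not> r (g u) (g v))"
proof -
  define n where "n = card V"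
  define N where "N = card VR"
  define j where "j = k - 2"
  define m where "m = j div 2"
  have k: "k = j + 2" "1 \<le> j" using assms(3) by (auto simp: j_def)
  have m: "k div 2 = Suc m" "2 * m \<le> j" "j \<le> 2 * m + 1" by (auto simp: m_def k(1))
  have N: "N = n + m" using VR by (simp add: N_def n_def m)
  have n20': "20 * (j * j) + 80 * j + 80 \<le> n"
    using n20 by (simp add: k(1) n_def power2_eq_square algebra_simps)
  have jj: "j \<le> j * j" using k(2) by simp
  have n160: "160 * j \<le> n"
  proof -
    have "real (4 * j) \<le> real (j * j + 4)"
      using zero_le_power2[of "real j - 2"] by (simp add: power2_eq_square algebra_simps)
    then have "4 * j \<le> j * j + 4" by (simp only: of_nat_le_iff)
    then show ?thesis using n20' by linarith
  qed
  have n180: "180 \<le> n" using n20' k(2) jj by linarith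
  have q27: "27 * ((j * j + 4 * j + 4) * q) \<le> n"
    using s(2) by (simp add: k(1) n_def power2_eq_square algebra_simps)
  have q243: "243 * q \<le> n"
  proof -
    have "9 * q \<le> (j * j + 4 * j + 4) * q" using k(2) jj by (intro mult_le_mono1) linarith
    then show ?thesis using q27 by linarith
  qed
  have qj1: "81 * ((2 * j + 1) * q) \<le> n"
  proof -
    have "real (2 * j) \<le> real (j * j + 1)"
      using zero_le_power2[of "real j - 1"] by (simp add: power2_eq_square algebra_simps)
    then have "2 * j \<le> j * j + 1" by (simp only: of_nat_le_iff)
    then have "3 * (2 * j + 1) \<le> j * j + 4 * j + 4" by (simp add: algebra_simps)
    then have "3 * (2 * j + 1) * q \<le> (j * j + 4 * j + 4) * q" by (rule mult_le_mono1)
    then show ?thesis using q27 by linarith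
  qed
  have qj2: "108 * ((2 * j) * q) \<le> n"
  proof -
    have "real (4 * j) \<le> real (j * j + 4)"
      using zero_le_power2[of "real j - 2"] by (simp add: power2_eq_square algebra_simps)
    then have "4 * j \<le> j * j + 4" by (simp only: of_nat_le_iff)
    then have "4 * (2 * j) * q \<le> (j * j + 4 * j + 4) * q" by (intro mult_le_mono1) linarith
    then show ?thesis using q27 by linarith
  qed
  interpret R: path_free_graph VR r k by fact
  have V2: "3 \<le> card V" using n180 by (simp add: n_def)
  then have "V \<noteq> {}" by auto
  then obtain rt par depth where rooted: "rooted_graph V E rt par depth"
    using ugraph.ex_rooted_graph[OF assms(1) conn] by blast
  interpret G: rooted_graph V E rt par depth by fact
  define K where "K = G.core"
  \<comment> \<open>The tree takes only \<open>2 * card V - 2\<close> of the degree sum, hence the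
    \<open>2\<close>.\<close>
  have K: "card K \<le> q + 2" using G.card_core s(1) V2 unfolding K_def by linarith
  define L where "L = {v \<in> V. G.deg v = 1}"
  define D where "D = (\<Sum>v\<in>V. G.deg v - 2)"
  have D: "D \<le> card L + q"
    using G.sum_deg_minus_two s(1) V2 unfolding D_def L_def by linarith
  define lo where "lo = card {y \<in> VR. R.deg y \<le> 2 * j}"
  \<comment> \<open>Enough low-degree vertices for an independent set of size \<open>card K\<close>,
    with \<open>k div 2\<close> to spare for those discarded or excluded beforehand.\<close>
  have lo: "card K * (2 * j + 1) + k div 2 \<le> lo"
  proof -
    have "N \<le> lo * (j + 1)" using R.card_low_degree_ge[OF k] by (simp add: lo_def N_def)
    moreover have "(card K * (2 * j + 1) + k div 2) * (j + 1) \<le> n"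
    proof -
      have "card K * (2 * j + 1) + k div 2 \<le> (q + 2) * (2 * j + 1) + (j + 1)"
        using K m by (intro add_le_mono mult_le_mono1) auto
      then have "(card K * (2 * j + 1) + k div 2) * (j + 1) \<le> ((q + 2) * (2 * j + 1) + (j + 1)) * (j + 1)"
        by (rule mult_le_mono1)
      also have "\<dots> = 2 * (j * j * q) + 3 * (j * q) + q + 5 * (j * j) + 8 * j + 3"
        by (simp add: algebra_simps)
      also have "\<dots> \<le> n"
      proof -
        have "27 * (j * j * q) + 108 * (j * q) + 108 * q \<le> n" using q27 by (simp add: algebra_simps)
        then show ?thesis using n20' by linarith
      qed
      finally show ?thesis .
    qed
    ultimately have "(card K * (2 * j + 1) + k div 2) * (j + 1) \<le> lo * (j + 1)" using N by linarith
    then show ?thesis unfolding mult_le_cancel2 by simp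
  qed
  have Kj: "card K * (2 * j + 1) \<le> (2 * j + 1) * q + 4 * j + 2"
    "card K * (2 * j) \<le> (2 * j) * q + 4 * j"
    using mult_le_mono1[OF K, of "2 * j + 1"] mult_le_mono1[OF K, of "2 * j"]
    by (simp_all add: algebra_simps)
  show ?thesis
  proof (cases "4 * card L \<le> n")
    case True
    \<comment> \<open>Small enough that \<open>5 * d\<close> and \<open>D\<close>, which is hardly
      more than \<open>n / 4\<close>, leave room for exchanges; large enough that at most
      \<open>N / 19\<close> vertices have degree above \<open>d\<close>.\<close>
    define d where "d = n div 8"
    define h where "h = card {y \<in> VR. d < R.deg y}"
    have d: "8 * d \<le> n" "n \<le> 8 * d + 8" by (auto simp: d_def)
    have h: "19 * h \<le> N"
    proof -
      define e where "e = d + 1 - j"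
      have "h * e \<le> j * N" using R.card_heavy[of d] by (simp add: h_def N_def k(1) e_def)
      then have "160 * (h * e) \<le> 160 * j * N" by simp
      also have "\<dots> \<le> n * N" using n160 by (rule mult_le_mono1)
      finally have "160 * (h * e) \<le> n * N" .
      moreover have "19 * n \<le> 160 * e" using d n160 n180 unfolding e_def by linarith
      ultimately show ?thesis by (rule mult_le_mult_imp_le) (use n180 in simp)
    qed
    show ?thesis
    proof (rule embed_few_leaves[OF rooted assms(2) VR K_def D_def, where \<delta> = "2 * j" and d = d and q = h])
      show "2 * j \<le> d" using d n160 n180 by linarith
      show "card {y \<in> VR. d < R.deg y} \<le> h" by (simp add: h_def)
      show "3 * h + 9 * card K + 2 * D + 2 \<le> card V"
        using h N m(2) K D True n160 n180 q243 unfolding n_def[symmetric] by linarith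
      show "card K * (2 * j + 1) + k div 2 \<le> card {y \<in> VR. R.deg y \<le> 2 * j}"
        using lo by (simp add: lo_def)
      show "6 * h + D + 2 * (card K * (2 * j + 1)) + card VR + k + 2 * d \<le> 2 * card V"
        using h N m(2) Kj(1) D True n160 n180 q243 qj1 d(1) k(1)
        unfolding n_def[symmetric] N_def[symmetric] by linarith
      show "h + 4 + 5 * d + D < card V"
        using h N m(2) D True n160 n180 q243 d(1) unfolding n_def[symmetric] by linarith
    qed
  next
    case False
    have fL: "finite L" using G.finite_V by (simp add: L_def)
    have Lne: "L \<noteq> {}" using False by auto
    define lv where "lv t = card {v \<in> L. E v t}" for t
    obtain x where x: "x \<in> V" "\<And>t. t \<in> V \<Longrightarrow> lv t \<le> lv x"
    proof -
      have "Max (lv ` V) \<in> lv ` V" using G.finite_V \<open>V \<noteq> {}\<close> by (intro Max_in) auto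
      then obtain x where "x \<in> V" "lv x = Max (lv ` V)" by auto
      then show thesis using that[of x] G.finite_V by simp
    qed
    have xmax: "lv t \<le> lv x" for t
    proof (cases "t \<in> V")
      case False
      then have "{v \<in> L. E v t} = {}" using G.in_V2 by auto
      then have "lv t = 0" unfolding lv_def by (simp only: card.empty)
      then show ?thesis by simp
    qed (rule x(2))
    have leafnb: "\<exists>w. G.nb i = {w}" if "i \<in> L" for i
      using that card_1_singletonE[of "G.nb i"] unfolding L_def G.deg_def by blast
    have xL: "x \<notin> L"
    proof -
      obtain i where i: "i \<in> L" using Lne by blast
      then obtain w where w: "G.nb i = {w}" using leafnb by blast
      then have "E i w" using G.in_nb[of w i] by simp
      then have "lv w > 0" using i fL by (auto simp: lv_def card_gt_0_iff)
      then have "lv x > 0" using xmax[of w] by simp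
      then obtain v where v: "v \<in> L" "E v x" unfolding lv_def card_gt_0_iff by blast
      obtain w' where w': "G.nb v = {w'}" using leafnb v(1) by blast
      then have "w' = x" using v(2) G.in_nb[of x v] by simp
      then show ?thesis using G.leaf_nb_not_leaf[OF w' V2] by (simp add: L_def)
    qed
    show ?thesis
    proof (cases "\<exists>y\<in>VR. R.deg y < k div 2")
      case True
      then obtain y where y: "y \<in> VR" "R.deg y < k div 2" by blast
      \<comment> \<open>Chosen so that \<open>(k div 2 + 1) * d\<close> is at most
        \<open>n / 4\<close>, hence less than the number of leaves. Still at most
        \<open>N / 9\<close> vertices have larger degree. As \<open>y\<close> has few neighbours,
        \<open>F\<close> can be empty.\<close>
      define d where "d = n div (2 * j + 8)"
      define h where "h = card {y \<in> VR. d < R.deg y}"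
      have d: "d * (2 * j + 8) \<le> n" "n \<le> (d + 1) * (2 * j + 8)"
        using div_mult_mod_eq[of n "2 * j + 8"] mod_less_divisor[of "2 * j + 8" n]
        by (simp_all add: d_def div_times_less_eq_dividend del: mod_less_divisor)
      have n10: "10 * (j * (2 * j + 8)) + 80 \<le> n" using n20' by (simp add: algebra_simps)
      have d10: "10 * d \<le> n"
      proof -
        have "d * 10 \<le> d * (2 * j + 8)" using k(2) by (intro mult_le_mono2) simp
        then show ?thesis using d(1) by linarith
      qed
      have h: "9 * h \<le> N"
      proof -
        define e where "e = d + 1 - j"
        define c where "c = 2 * j + 8"
        have "h * e \<le> j * N" using R.card_heavy[of d] by (simp add: h_def N_def k(1) e_def)
        then have "10 * (h * e * c) \<le> 10 * (j * N * c)"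
          by (intro mult_le_mono2 mult_le_mono1)
        also have "\<dots> = 10 * (j * c) * N" by (simp add: algebra_simps)
        also have "\<dots> \<le> n * N" using n10 unfolding c_def by (intro mult_le_mono1) simp
        finally have "10 * (h * (e * c)) \<le> n * N" by (simp only: mult.assoc)
        moreover have "9 * n \<le> 10 * (e * c)"
        proof -
          have "10 * (e * c) = 10 * ((d + 1) * c) - 10 * (j * c)"
            unfolding e_def by (simp only: diff_mult_distrib diff_mult_distrib2)
          then show "9 * n \<le> 10 * (e * c)" using d(2) n10 unfolding c_def by linarith
        qed
        ultimately show ?thesis by (rule mult_le_mult_imp_le) (use n180 in simp)
      qed
      have hd: "card {y \<in> VR. R.deg y \<le> d} + h = N"
        using R.card_low_degree[of d] by (simp add: h_def N_def)
      have dj: "2 * j \<le> d"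
      proof (rule ccontr)
        assume "\<not> 2 * j \<le> d"
        then have "(d + 1) * (2 * j + 8) \<le> (2 * j) * (2 * j + 8)" by (intro mult_le_mono1) simp
        then show False using d(2) n10 by simp
      qed
      show ?thesis
      proof (rule embed_many_leaves[OF rooted assms(2) VR V2 L_def, where x = x and F = "{}" and
            p = "\<lambda>_. y" and d = d and b = m and \<delta> = "2 * j" and K = K])
        show "x \<in> V - L" using x(1) xL by simp
        show "card {v \<in> L. E v t} \<le> card {v \<in> L. E v x}" for t using xmax by (simp add: lv_def)
        show "(\<lambda>_. y) ` insert x {} \<subseteq> VR" using y by simp
        show "card (R.nb y - (\<lambda>_. y) ` {}) < k div 2" using y(2) by (simp add: R.deg_def)
        show "R.deg y \<le> d" if "u \<in> insert x {}" for u using y(2) m dj by linarith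
        show "card (\<Union>u\<in>insert x {}. R.nb y) \<le> m" using y(2) m(1) by (simp add: R.deg_def)
        show "K = G.core" by (rule K_def)
        show "2 * j \<le> d" by (rule dj)
        show "card K * (2 * j + 1) + Suc (card {}) + m \<le> card {y \<in> VR. R.deg y \<le> 2 * j}"
          using lo m(1) by (simp add: lo_def)
        show "card V + card {} + card K * (2 * j) + m + d \<le> card {y \<in> VR. R.deg y \<le> d} + card L"
          using hd h Kj(2) qj2 n160 d10 False N m(2) unfolding n_def[symmetric] card.empty by linarith
        have "4 * ((k div 2 + 1) * (d + 1 - k div 2)) \<le> 4 * ((m + 2) * d)"
          using m(1) by (intro mult_le_mono) auto
        also have "\<dots> = d * (4 * m + 8)" by (simp add: algebra_simps)
        also have "\<dots> \<le> d * (2 * j + 8)" using m(2) by (intro mult_le_mono2) simp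
        finally have "4 * ((k div 2 + 1) * (d + 1 - k div 2)) \<le> n" using d(1) by linarith
        then show "(k div 2 + 1) * (d + 1 - k div 2) + card {} < card L" using False by simp
      qed auto
    next
      case nolow: False
      then have dj: "\<And>y. y \<in> VR \<Longrightarrow> R.deg y \<le> j" using R.min_degree_dichotomy by (auto simp: j_def)
      have "VR \<noteq> {}" using N n180 by (auto simp: N_def)
      then obtain y where y: "y \<in> VR" by blast
      define t where "t = R.deg y - m"
      have tj: "t \<le> j - m" using dj[OF y] by (simp add: t_def)
      have "\<exists>F\<subseteq>V - {x}. card F = t \<and> (\<forall>v\<in>F. \<not> E x v) \<and> (\<forall>u\<in>F. \<forall>v\<in>F. \<not> E u v)"
      proof (rule G.ex_independent_nonneighbours[OF x(1)])
        show "20 * (j + 2) ^ 2 \<le> card V" "27 * (j + 2) ^ 2 * q \<le> card V"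
          using n20 s(2) by (simp_all add: k(1))
        show "2 * t \<le> j + 1" using tj m by linarith
      qed (use s(1) \<Delta> x(1) k(2) in auto)
      then obtain F where F: "F \<subseteq> V - {x}" "card F = t" "\<And>v. v \<in> F \<Longrightarrow> \<not> E x v"
        "\<And>u v. u \<in> F \<Longrightarrow> v \<in> F \<Longrightarrow> \<not> E u v" by blast
      have fF: "finite F" using F(1) G.finite_V finite_subset by blast
      obtain T where T: "T \<subseteq> R.nb y" "card T = t" "finite T"
        using obtain_subset_with_card_n[of t "R.nb y"] by (auto simp: t_def R.deg_def)
      obtain f1 where f1: "bij_betw f1 F T" using finite_same_card_bij[OF fF T(3)] F(2) T(2) by auto
      define f0 where "f0 u = (if u = x then y else f1 u)" for u
      have f0F: "f0 ` F = T" using f1 F(1) by (auto simp: f0_def bij_betw_def image_iff)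
      have f0V: "f0 ` insert x F \<subseteq> VR" using f0F T(1) R.nb_subset y by (auto simp: f0_def)
      have tle: "t \<le> j" using tj by simp
      \<comment> \<open>All degrees are at most \<open>j\<close>, so \<open>j\<close> serves for
        both thresholds and no vertex is excluded by them.\<close>
      have all: "{y \<in> VR. R.deg y \<le> j} = VR" using dj by auto
      have Kj': "card K * (j + 1) \<le> (j + 1) * q + 2 * j + 2" "card K * j \<le> j * q + 2 * j"
        using mult_le_mono1[OF K, of "j + 1"] mult_le_mono1[OF K, of j] by (simp_all add: algebra_simps)
      have tj2: "Suc t * j \<le> (j + 1) * j" using tle by (intro mult_le_mono1) simp
      show ?thesis
      proof (rule embed_many_leaves[OF rooted assms(2) VR V2 L_def, where x = x and F = F and
            p = f0 and d = j and b = "Suc t * j" and \<delta> = j and K = K])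
        show "x \<in> V - L" using x(1) xL by simp
        show "card {v \<in> L. E v t} \<le> card {v \<in> L. E v x}" for t using xmax by (simp add: lv_def)
        show "F \<subseteq> V - {x}" by (rule F(1))
        show "\<not> E x v" if "v \<in> F" for v using F(3)[OF that] .
        show "\<not> E u v" if "u \<in> F" "v \<in> F" for u v using F(4)[OF that] .
        have "inj_on f0 F" using f1 F(1) by (auto simp: f0_def bij_betw_def inj_on_def)
        moreover have "f0 x \<notin> f0 ` F" using f0F T(1) R.irrefl by (auto simp: f0_def)
        ultimately show "inj_on f0 (insert x F)" by (auto simp: inj_on_insert)
        show "f0 ` insert x F \<subseteq> VR" by (rule f0V)
        have "f0 x = y" by (simp add: f0_def)
        then have "card (R.nb (f0 x) - f0 ` F) = R.deg y - t"
          using T unfolding f0F by (simp add: card_Diff_subset R.deg_def)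
        then show "card (R.nb (f0 x) - f0 ` F) < k div 2" using m(1) by (simp add: t_def)
        show deg: "R.deg (f0 u) \<le> j" if "u \<in> insert x F" for u using dj f0V that by blast
        have "card (\<Union>y\<in>f0 ` insert x F. R.nb y) \<le> card (f0 ` insert x F) * j"
          using fF deg by (intro R.card_UN_nb_le) auto
        also have "\<dots> \<le> Suc t * j"
          using card_image_le[of "insert x F" f0] fF F(2)
          by (intro mult_le_mono1) (simp add: card_insert_if split: if_splits)
        finally show "card (\<Union>u\<in>insert x F. R.nb (f0 u)) \<le> Suc t * j" by simp
        show "K = G.core" by (rule K_def)
        have jq: "81 * ((j + 1) * q) \<le> n" using qj1 by (simp add: algebra_simps)
        have jq': "81 * (j * q) \<le> n" using jq by (simp add: algebra_simps)
        have tj3: "Suc t * j \<le> j * j + j" using tj2 by (simp add: algebra_simps)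
        show "card K * (j + 1) + Suc (card F) + Suc t * j \<le> card {y \<in> VR. R.deg y \<le> j}"
          unfolding all F(2) N_def[symmetric]
          using Kj'(1) jq tj3 tle n20' N by linarith
        show "card V + card F + card K * j + Suc t * j + j \<le> card {y \<in> VR. R.deg y \<le> j} + card L"
          unfolding all F(2) N_def[symmetric] n_def[symmetric]
          using Kj'(2) jq' tj3 tle n20' N False n160 by linarith
        have "(k div 2 + 1) * (j + 1 - k div 2) \<le> (j + 2) * j"
          using m k(2) by (intro mult_le_mono) linarith+
        then have "(k div 2 + 1) * (j + 1 - k div 2) \<le> j * j + 2 * j" by (simp add: algebra_simps)
        then show "(k div 2 + 1) * (j + 1 - k div 2) + card F < card L"
          using False n20' F(2) tle by linarith
      qed auto
    qed
  qed
qed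

section \<open>The Ramsey number\<close>

lemma ugraph_of_pair_graph:
  assumes "pair_graph G"
  shows "ugraph (pverts G) (\<lambda>u v. (u, v) \<in> parcs G)"
proof -
  interpret G: pair_graph G by fact
  have "Relation.sym (parcs G)" using G.pair_sym_arcs by (simp add: symmetric_def)
  then have "(v, u) \<in> parcs G" if "(u, v) \<in> parcs G" for u v using that by (rule symD)
  moreover have "(v, v) \<notin> parcs G" for v using G.pair_no_loops[of "(v, v)"] by auto
  moreover have "u \<in> pverts G" if "(u, v) \<in> parcs G" for u v
    using G.arc_fst_in_verts[OF that] by simp
  ultimately show ?thesis by (intro ugraph.intro G.pair_finite_verts)
qed

text \<open>The first \<open>k\<close> vertices of a longer path already carry a copy of
  \<open>path_graph k\<close>.\<close>

lemma path_free_of_no_path_graph: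
  assumes "pair_graph G" "\<not> contains_graph G (path_graph k)" "2 \<le> k"
  shows "path_free_graph (pverts G) (\<lambda>u v. (u, v) \<in> parcs G) k"
proof -
  interpret ugraph "pverts G" "\<lambda>u v. (u, v) \<in> parcs G"
    using assms(1) by (rule ugraph_of_pair_graph)
  have "length xs < k" if "gpath xs" for xs
  proof (rule ccontr)
    assume k: "\<not> length xs < k"
    have xs: "distinct xs" "set xs \<subseteq> pverts G" "successively (\<lambda>u v. (u, v) \<in> parcs G) xs"
      using that by (auto simp: gpath_def)
    have "inj_on ((!) xs) {..<k}" using xs(1) k by (auto simp: inj_on_def nth_eq_iff_index_eq)
    moreover have "(!) xs ` {..<k} \<subseteq> pverts G" using xs(2) k by auto
    moreover have "(xs ! i, xs ! j) \<in> parcs G" if "(i, j) \<in> parcs (path_graph k)" for i j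
    proof -
      have "j = Suc i \<or> i = Suc j" "i < k" "j < k" using that by (auto simp: path_graph_def)
      then show ?thesis
        using successively_nth[OF xs(3), of i] successively_nth[OF xs(3), of j] k sym by auto
    qed
    ultimately have "contains_graph G (path_graph k)"
      unfolding contains_graph_iff_embedding[OF assms(1) pair_graph_path_graph]
      by (intro exI[of _ "(!) xs"]) (simp add: path_graph_def)
    then show False using assms(2) by simp
  qed
  then show ?thesis using assms(3) by unfold_locales auto
qed

lemma card_parcs_le:
  assumes "pair_graph G"
  shows "card (parcs G) \<le> 2 * card (uedges G)"
proof -
  interpret G: pair_graph G by fact
  have fin: "finite (parcs G)" by (rule G.pair_finite_arcs)
  have eq: "uedges G = (\<lambda>(u, v). {u, v}) ` parcs G" by (auto simp: uedges_def)
  have "parcs G = (\<Union>e\<in>uedges G. {a \<in> parcs G. (\<lambda>(u, v). {u, v}) a = e})"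
    unfolding eq by auto
  then have "card (parcs G) = card (\<Union>e\<in>uedges G. {a \<in> parcs G. (\<lambda>(u, v). {u, v}) a = e})"
    by simp
  also have "\<dots> \<le> (\<Sum>e\<in>uedges G. card {a \<in> parcs G. (\<lambda>(u, v). {u, v}) a = e})"
    using fin unfolding eq by (intro card_UN_le) simp
  also have "\<dots> \<le> (\<Sum>e\<in>uedges G. 2)"
  proof (rule sum_mono)
    fix e assume "e \<in> uedges G"
    then obtain u v where e: "e = {u, v}" by (auto simp: uedges_def)
    have "a = (u, v) \<or> a = (v, u)" if "(\<lambda>(u, v). {u, v}) a = e" for a
    proof (cases a)
      case (Pair x y)
      then have "{x, y} = {u, v}" using that unfolding e by simp
      then show ?thesis unfolding Pair doubleton_eq_iff by simp
    qed
    then have "{a \<in> parcs G. (\<lambda>(u, v). {u, v}) a = e} \<subseteq> {(u, v), (v, u)}" by blast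
    then have "card {a \<in> parcs G. (\<lambda>(u, v). {u, v}) a = e} \<le> card {(u, v), (v, u)}"
      by (intro card_mono) auto
    also have "\<dots> \<le> 2" using card_length[of "[(u, v), (v, u)]"] by simp
    finally show "card {a \<in> parcs G. (\<lambda>(u, v). {u, v}) a = e} \<le> 2" .
  qed
  finally show ?thesis by simp
qed

lemma out_degree_eq_deg:
  assumes "pair_graph G"
  shows "out_degree (with_proj G) v = ugraph.deg (\<lambda>u v. (u, v) \<in> parcs G) v"
proof -
  interpret ugraph "pverts G" "\<lambda>u v. (u, v) \<in> parcs G"
    using assms by (rule ugraph_of_pair_graph)
  have "bij_betw (\<lambda>w. (v, w)) (nb v) (out_arcs (with_proj G) v)"
    by (auto simp: bij_betw_def inj_on_def out_arcs_def image_iff)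
  then show ?thesis
    unfolding out_degree_def deg_def by (metis bij_betw_same_card)
qed

text \<open>Connectedness refers to the symmetric closure of the arcs, which is contained in the arc
  set itself.\<close>

lemma connected_rtrancl:
  assumes "pair_graph G" "Digraph_Component.connected (with_proj G)" "u \<in> pverts G" "v \<in> pverts G"
  shows "(u, v) \<in> (parcs G)\<^sup>*"
proof -
  interpret G: pair_graph G by fact
  have "u \<rightarrow>\<^sup>*\<^bsub>with_proj (mk_symmetric (with_proj G))\<^esub> v"
    using assms(2-4) by (auto simp: Digraph_Component.connected_def strongly_connected_def)
  then have "(u, v) \<in> (arcs_ends (with_proj (mk_symmetric (with_proj G))))\<^sup>*"
    by (rule reachable_rtranclI)
  moreover have "Relation.sym (parcs G)" using G.pair_sym_arcs by (simp add: symmetric_def)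
  then have "parcs (mk_symmetric (with_proj G)) \<subseteq> parcs G"
    by (auto simp: parcs_mk_symmetric dest: symD)
  then have "arcs_ends (with_proj (mk_symmetric (with_proj G))) \<subseteq> parcs G"
    by (auto simp: arcs_ends_def arc_to_ends_def)
  ultimately show ?thesis using rtrancl_mono by blast
qed

text \<open>A copy of \<open>G\<close> in \<open>\<Gamma>\<close> is an injective placement that
  sends no edge to an edge of the complement, and the complement has no path on \<open>k\<close>
  vertices. For \<open>k = 2\<close> it has no edges, so any injection works.\<close>

lemma ramsey_upper_bound:
  fixes G :: "'a pair_pre_digraph" and \<Gamma> :: "nat pair_pre_digraph"
  assumes k: "k \<ge> 2" and n: "n \<ge> 20 * k ^ 2"
    and G: "pair_graph G" "Digraph_Component.connected (with_proj G)" "card (pverts G) = n"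
    and e: "real (card (uedges G)) \<le> (1 + 1 / (54 * real k ^ 2)) * real n"
    and \<Delta>: "real (max_degree G) < real n - sqrt (real n) / 2"
    and \<Gamma>: "pair_graph \<Gamma>" "card (pverts \<Gamma>) = n + k div 2 - 1"
      "\<not> contains_graph (complement_graph \<Gamma>) (path_graph k)"
  shows "contains_graph \<Gamma> G"
proof -
  let ?E = "\<lambda>u v. (u, v) \<in> parcs G"
  let ?r = "\<lambda>u v. (u, v) \<in> parcs (complement_graph \<Gamma>)"
  interpret E: ugraph "pverts G" ?E using G(1) by (rule ugraph_of_pair_graph)
  have comp: "pverts (complement_graph \<Gamma>) = pverts \<Gamma>" by (simp add: complement_graph_def)
  interpret R: path_free_graph "pverts \<Gamma>" ?r k
    using path_free_of_no_path_graph[OF pair_graph_complement_graph[OF \<Gamma>(1)] \<Gamma>(3) k]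
    unfolding comp .
  have VR: "card (pverts \<Gamma>) = card (pverts G) + (k div 2 - 1)" using \<Gamma>(2) G(3) k by simp
  have "\<exists>g. inj_on g (pverts G) \<and> g ` pverts G \<subseteq> pverts \<Gamma> \<and> (\<forall>u v. ?E u v \<longrightarrow> \<not> ?r (g u) (g v))"
  proof (cases "k = 2")
    case True
    have "\<not> ?r a b" for a b
    proof
      assume ab: "?r a b"
      then have "R.gpath [a, b]" using R.in_V R.in_V2 R.irrefl by (auto simp: R.gpath_def)
      from R.path_free[OF this] True show False by simp
    qed
    moreover have "\<exists>g. g ` pverts G \<subseteq> pverts \<Gamma> \<and> inj_on g (pverts G)"
      using VR True by (intro card_le_inj E.finite_V R.finite_V) simp
    ultimately show ?thesis by blast
  next
    case False
    \<comment> \<open>The edge bound allows at most \<open>n / (54 * k ^ 2)\<close> edges beyond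
      \<open>n\<close>, each giving two arcs; with at most \<open>2 * n\<close> arcs
      \<open>q\<close> is \<open>0\<close>.\<close>
    define q where "q = card (parcs G) - 2 * n"
    have s: "(\<Sum>v\<in>pverts G. E.deg v) = card (parcs G)" by (simp add: E.sum_deg)
    have n0: "0 < n" using n k by (metis add_gr_0 less_le_trans mult_pos_pos power_eq_0_iff
        gr0I not_numeral_le_zero zero_less_numeral)
    have deg: "real (E.deg v) < real n - sqrt (real n) / 2" if "v \<in> pverts G" for v
    proof -
      have "E.deg v \<le> max_degree G"
        unfolding max_degree_def out_degree_eq_deg[OF G(1), symmetric]
        using that E.finite_V by (intro Max_ge) auto
      then show ?thesis using \<Delta> by linarith
    qed
    show ?thesis
    proof (rule sparse_graph_embedding[OF E.ugraph_axioms R.path_free_graph_axioms _ VR, where q = q])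
      show "3 \<le> k" using False k by simp
      show "20 * k ^ 2 \<le> card (pverts G)" using n G(3) by simp
      show "(u, v) \<in> {(u, v). ?E u v}\<^sup>*" if "u \<in> pverts G" "v \<in> pverts G" for u v
        using connected_rtrancl[OF G(1,2) that] by simp
      show "(\<Sum>v\<in>pverts G. E.deg v) \<le> 2 * card (pverts G) + q"
        unfolding s G(3) q_def by simp
      show "27 * k ^ 2 * q \<le> card (pverts G)"
      proof (cases "card (parcs G) \<le> 2 * n")
        case False
        have "real q = real (card (parcs G)) - 2 * real n" using False by (simp add: q_def of_nat_diff)
        also have "\<dots> \<le> 2 * real (card (uedges G)) - 2 * real n"
          using card_parcs_le[OF G(1)] by linarith
        also have "\<dots> \<le> real n / (27 * real k ^ 2)" using e by (simp add: algebra_simps)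
        finally have "27 * real k ^ 2 * real q \<le> real n" using k by (simp add: field_simps)
        then have "real (27 * k ^ 2 * q) \<le> real n" by simp
        then show ?thesis unfolding G(3) by (simp only: of_nat_le_iff)
      qed (simp add: q_def)
      fix v assume v: "v \<in> pverts G"
      have "real (E.deg v) < real n" using deg[OF v] real_sqrt_ge_zero[of "real n"] by linarith
      then show "E.deg v < card (pverts G)" using G(3) by simp
      then have r: "real (n - E.deg v) = real n - real (E.deg v)" using G(3) by (simp add: of_nat_diff)
      have "sqrt (real n) < 2 * real (n - E.deg v)" unfolding r using deg[OF v] by (simp add: field_simps)
      then have "(sqrt (real n)) ^ 2 < (2 * real (n - E.deg v)) ^ 2"
        by (intro power_strict_mono) auto
      then have "real n < real (4 * (n - E.deg v) ^ 2)" by (simp add: power_mult_distrib)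
      then show "card (pverts G) < 4 * (card (pverts G) - E.deg v) ^ 2"
        unfolding G(3) by (simp only: of_nat_less_iff)
    qed
  qed
  then obtain g where g: "inj_on g (pverts G)" "g ` pverts G \<subseteq> pverts \<Gamma>"
    "\<And>u v. ?E u v \<Longrightarrow> \<not> ?r (g u) (g v)" by blast
  have "(g u, g v) \<in> parcs \<Gamma>" if uv: "(u, v) \<in> parcs G" for u v
  proof -
    have V: "u \<in> pverts G" "v \<in> pverts G" "u \<noteq> v" using E.in_V[OF uv] E.in_V2[OF uv] E.irrefl uv by auto
    then have "g u \<noteq> g v" using g(1) by (auto simp: inj_on_def)
    then show ?thesis using g(2) g(3)[OF uv] V by (auto simp: complement_graph_def)
  qed
  then show ?thesis
    unfolding contains_graph_iff_embedding[OF \<Gamma>(1) G(1)] using g(1,2) by blast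
qed

section \<open>The lower bound: two disjoint cliques\<close>

definition two_cliques :: "nat \<Rightarrow> nat \<Rightarrow> nat pair_pre_digraph" where
  "two_cliques a N = \<lparr> pverts = {..<N},
     parcs = {(u, v). u < N \<and> v < N \<and> u \<noteq> v \<and> (u < a \<longleftrightarrow> v < a)} \<rparr>"

lemma pair_graph_two_cliques: "pair_graph (two_cliques a N)"
proof -
  have "finite (parcs (two_cliques a N))"
    by (rule finite_subset[of _ "{..<N} \<times> {..<N}"]) (auto simp: two_cliques_def)
  then show ?thesis by unfold_locales (auto simp: two_cliques_def symmetric_def sym_def)
qed

text \<open>Adjacent vertices lie in the same clique, so a connected graph would have to fit into
  one of the two.\<close>

lemma two_cliques_not_contains:
  assumes "pair_graph G" "Digraph_Component.connected (with_proj G)"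
    and "a < card (pverts G)" "N - a < card (pverts G)"
  shows "\<not> contains_graph (two_cliques a N) G"
proof
  assume "contains_graph (two_cliques a N) G"
  then obtain f where f: "inj_on f (pverts G)" "f ` pverts G \<subseteq> {..<N}"
    "\<And>u v. (u, v) \<in> parcs G \<Longrightarrow> f u < a \<longleftrightarrow> f v < a"
    unfolding contains_graph_iff_embedding[OF pair_graph_two_cliques assms(1)]
    by (auto simp: two_cliques_def)
  have same: "f u < a \<longleftrightarrow> f v < a" if "(u, v) \<in> (parcs G)\<^sup>*" for u v
    using that by induction (use f(3) in auto)
  have "pverts G \<noteq> {}" using assms(3) by auto
  then obtain u where u: "u \<in> pverts G" by blast
  have all: "f v < a \<longleftrightarrow> f u < a" if "v \<in> pverts G" for v
    using same[OF connected_rtrancl[OF assms(1,2) u that]] by simp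
  have "f ` pverts G \<subseteq> {..<a} \<or> f ` pverts G \<subseteq> {a..<N}"
    using all f(2) by (cases "f u < a") (auto simp: image_subset_iff not_less[symmetric])
  then have "card (f ` pverts G) \<le> a \<or> card (f ` pverts G) \<le> N - a"
    by (metis card_atLeastLessThan card_lessThan card_mono finite_atLeastLessThan finite_lessThan)
  then show False using f(1) assms(3,4) by (simp add: card_image)
qed

text \<open>The complement is bipartite, so of any two consecutive path vertices one lies in the
  second clique. The \<open>k div 2\<close> disjoint pairs at positions \<open>2 * i\<close> and
  \<open>2 * i + 1\<close> need that many different vertices there.\<close>

lemma complement_two_cliques_not_contains:
  assumes "N - a < k div 2"
  shows "\<not> contains_graph (complement_graph (two_cliques a N)) (path_graph k)"
proof
  assume "contains_graph (complement_graph (two_cliques a N)) (path_graph k)"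
  then obtain f where f: "inj_on f {..<k}" "f ` {..<k} \<subseteq> {..<N}"
    "\<And>i j. (i, j) \<in> parcs (path_graph k) \<Longrightarrow> (f i, f j) \<in> parcs (complement_graph (two_cliques a N))"
    unfolding contains_graph_iff_embedding[OF pair_graph_complement_graph[OF pair_graph_two_cliques]
        pair_graph_path_graph]
    by (auto simp: complement_graph_def two_cliques_def path_graph_def)
  have edge: "a \<le> f i \<or> a \<le> f (Suc i)" if "Suc i < k" for i
    using f(3)[of i "Suc i"] that by (auto simp: path_graph_def complement_graph_def two_cliques_def)
  define h where "h i = (if a \<le> f (2 * i) then 2 * i else 2 * i + 1)" for i
  have h: "h i < k" "a \<le> f (h i)" "h i div 2 = i" if "i < k div 2" for i
    using edge[of "2 * i"] that by (auto simp: h_def)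
  have "inj_on h {..<k div 2}" using h(3) by (intro inj_on_inverseI[of _ "\<lambda>i. i div 2"]) simp
  moreover have "h ` {..<k div 2} \<subseteq> {..<k}" using h(1) by auto
  then have "inj_on f (h ` {..<k div 2})" by (rule inj_on_subset[OF f(1)])
  ultimately have "inj_on (f \<circ> h) {..<k div 2}" by (rule comp_inj_on)
  moreover have "(f \<circ> h) ` {..<k div 2} \<subseteq> {a..<N}" using h(1,2) f(2) by (force simp: image_subset_iff)
  ultimately have "card {..<k div 2} \<le> card {a..<N}"
    by (rule card_inj_on_le) simp
  then show False using assms by simp
qed

theorem corollary1p3:
  fixes G :: "'a pair_pre_digraph" and k n :: nat
  assumes "k \<ge> 2"
    and "n \<ge> 20 * k ^ 2"
    and "pair_graph G"
    and "Digraph_Component.connected (with_proj G)"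
    and "card (pverts G) = n"
    and "real (card (uedges G)) \<le> (1 + 1 / (54 * real k ^ 2)) * real n"
    and "real (max_degree G) < real n - sqrt (real n) / 2"
  shows "ramsey_number G (path_graph k) = n + k div 2 - 1"
  unfolding ramsey_number_def
proof (rule Least_equality)
  have "k * 1 \<le> k * k" using assms(1) by (intro mult_le_mono2) simp
  then have kn: "k \<le> n" using assms(2) unfolding power2_eq_square by linarith
  show "0 < n + k div 2 - 1 \<and> (\<forall>\<Gamma> :: nat pair_pre_digraph.
      pair_graph \<Gamma> \<and> card (pverts \<Gamma>) = n + k div 2 - 1 \<longrightarrow>
      contains_graph \<Gamma> G \<or> contains_graph (complement_graph \<Gamma>) (path_graph k))"
    using ramsey_upper_bound[OF assms] kn assms(1) by auto
  fix N
  assume N: "0 < N \<and> (\<forall>\<Gamma> :: nat pair_pre_digraph. pair_graph \<Gamma> \<and> card (pverts \<Gamma>) = N \<longrightarrow>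
      contains_graph \<Gamma> G \<or> contains_graph (complement_graph \<Gamma>) (path_graph k))"
  show "n + k div 2 - 1 \<le> N"
  proof (rule ccontr)
    assume "\<not> n + k div 2 - 1 \<le> N"
    \<comment> \<open>Every smaller \<open>N\<close> is treated, so the second clique may have fewer
      than \<open>k div 2 - 1\<close> vertices, or none when \<open>N < n\<close>.\<close>
    then have small: "N - (n - 1) < k div 2" using kn assms(1) by linarith
    have "\<not> contains_graph (two_cliques (n - 1) N) G"
      using small kn assms(1,5) by (intro two_cliques_not_contains assms(3,4)) linarith+
    moreover have "\<not> contains_graph (complement_graph (two_cliques (n - 1) N)) (path_graph k)"
      using small by (rule complement_two_cliques_not_contains)
    moreover have "card (pverts (two_cliques (n - 1) N)) = N" by (simp add: two_cliques_def)
    ultimately show False using N pair_graph_two_cliques by blast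
  qed
qed

end
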